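(* For each $n\ge 3$ let $T_n$ be a $2$-dimensional determinantal hypertree on the vertex set $[n]=\{1,\dots,n\}$. Then \[\frac{\dim H_1(T_n,\mathbb{F}_2)}{n^2}\] converges to $0$ in probability as $n\to\infty$.
   Context: A $2$-dimensional simplicial complex $S$ on the vertex set $[n]$ is a (2-dimensional) hypertree if (a) $S$ has complete $1$-skeleton (all $\binom n2$ edges), (b) $S$ has exactly $\binom{n-1}{2}$ triangular faces, and (c) the homology group $H_1(S,\mathbb{Z})$ is finite. By Kalai's formula, $\sum_S |H_1(S,\mathbb{Z})|^2 = n^{\binom{n-2}{2}}$, the sum over all hypertrees on $[n]$. A determinantal hypertree $T_n$ is a random hypertree on $[n]$ such that each hypertree $S$ is chosen with probability $|H_1(S,\mathbb{Z})|^2 / n^{\binom{n-2}{2}}$. *)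

theory Defs
  imports
    "HOL-Probability.Probability"
    "HOL-Library.Z2"
    "HOL-Algebra.AbelCoset"
    "Jordan_Normal_Form.VS_Connect"
begin

section \<open>Quotient modules\<close>

text \<open>The multiplicative fields of a module record are irrelevant and left unspecified.\<close>

definition quotient_module :: "('r, 'm) module \<Rightarrow> 'm set \<Rightarrow> ('r, 'm set) module" where
  "quotient_module M N =
    \<lparr>carrier = a_rcosets\<^bsub>M\<^esub> N, mult = undefined, one = undefined,
     zero = N, add = set_add M,
     smult = (\<lambda>a X. \<Union>x\<in>X. N +>\<^bsub>M\<^esub> (a \<odot>\<^bsub>M\<^esub> x))\<rparr>"

section \<open>Simplicial homology of finite complexes on natural-number vertices\<close>

text \<open>The empty set is not counted as a face, so the homology below is unreduced.\<close>

definition abstract_complex :: "nat set set \<Rightarrow> bool" where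
  "abstract_complex K \<longleftrightarrow>
     finite K \<and> (\<forall>\<sigma>\<in>K. finite \<sigma> \<and> \<sigma> \<noteq> {}) \<and>
     (\<forall>\<sigma>\<in>K. \<forall>\<tau>. \<tau> \<subseteq> \<sigma> \<and> \<tau> \<noteq> {} \<longrightarrow> \<tau> \<in> K)"

definition faces :: "nat set set \<Rightarrow> nat \<Rightarrow> nat set set" where
  "faces K k = {\<sigma> \<in> K. card \<sigma> = k + 1}"

text \<open>A chain is given by its coefficients: \<^term>\<open>c \<sigma>\<close> is the coefficient of the face \<open>\<sigma>\<close>,
  oriented by the increasing order of its vertices.\<close>

definition k_chains :: "nat set set \<Rightarrow> nat \<Rightarrow> (nat set \<Rightarrow> 'r::comm_ring_1) set" where
  "k_chains K k = {c. \<forall>\<sigma>. \<sigma> \<notin> faces K k \<longrightarrow> c \<sigma> = 0}"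

text \<open>For \<open>v\<^sub>0 < \<dots> < v\<^sub>k\<close>, the boundary of \<open>[v\<^sub>0, \<dots>, v\<^sub>k]\<close> is the sum over \<open>i\<close> of
  \<open>(- 1) ^ i\<close> times the face omitting \<open>v\<^sub>i\<close>. Hence the coefficient of \<open>\<tau>\<close> in the boundary of \<open>c\<close>
  collects \<open>c (insert v \<tau>)\<close> over all \<open>v \<notin> \<tau>\<close>, with the sign determined by the position of \<open>v\<close>
  in \<open>insert v \<tau>\<close>.\<close>

definition boundary ::
  "nat set set \<Rightarrow> (nat set \<Rightarrow> 'r::comm_ring_1) \<Rightarrow> (nat set \<Rightarrow> 'r)" where
  "boundary K c \<tau> =
     (if \<tau> \<in> K then
        \<Sum>v \<in> {v. v \<notin> \<tau> \<and> insert v \<tau> \<in> K}. (- 1) ^ card {u \<in> \<tau>. u < v} * c (insert v \<tau>)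
      else 0)"

definition k_cycles :: "nat set set \<Rightarrow> nat \<Rightarrow> (nat set \<Rightarrow> 'r::comm_ring_1) set" where
  "k_cycles K k = {c \<in> k_chains K k. boundary K c = (\<lambda>_. 0)}"

definition k_boundaries :: "nat set set \<Rightarrow> nat \<Rightarrow> (nat set \<Rightarrow> 'r::comm_ring_1) set" where
  "k_boundaries K k = boundary K ` k_chains K (Suc k)"

definition cycle_module ::
  "nat set set \<Rightarrow> nat \<Rightarrow> ('r::comm_ring_1, nat set \<Rightarrow> 'r) module" where
  "cycle_module K k =
    \<lparr>carrier = k_cycles K k, mult = undefined, one = undefined,
     zero = (\<lambda>_. 0), add = (\<lambda>c d \<sigma>. c \<sigma> + d \<sigma>), smult = (\<lambda>a c \<sigma>. a * c \<sigma>)\<rparr>"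

definition homology ::
  "nat set set \<Rightarrow> nat \<Rightarrow> ('r::comm_ring_1, (nat set \<Rightarrow> 'r) set) module" where
  "homology K k = quotient_module (cycle_module K k) (k_boundaries K k)"

lemma boundary_add: "boundary K (\<lambda>\<sigma>. c \<sigma> + d \<sigma>) = (\<lambda>\<sigma>. boundary K c \<sigma> + boundary K d \<sigma>)"
  by (rule ext) (simp add: boundary_def sum.distrib algebra_simps)

lemma boundary_scale: "boundary K (\<lambda>\<sigma>. a * c \<sigma>) = (\<lambda>\<sigma>. a * boundary K c \<sigma>)"
  by (rule ext) (simp add: boundary_def sum_distrib_left algebra_simps)

lemma boundary_boundary:
  assumes K: "abstract_complex K"
  shows "boundary K (boundary K c) = (\<lambda>_. 0)"
proof
  fix \<tau>
  show "boundary K (boundary K c) \<tau> = 0"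
  proof (cases "\<tau> \<in> K")
    case False then show ?thesis by (simp add: boundary_def)
  next
    case True
    have fK: "finite K" and ft: "finite \<tau>" using K True by (auto simp: abstract_complex_def)
    have fU: "finite (\<Union>K)" using K by (auto simp: abstract_complex_def)
    have down: "insert v \<tau> \<in> K" if "insert v (insert w \<tau>) \<in> K" for v w
    proof -
      have "insert v \<tau> \<subseteq> insert v (insert w \<tau>)" "insert v \<tau> \<noteq> {}" by auto
      then show ?thesis using K that unfolding abstract_complex_def by blast
    qed
    define s where "s v = card {u \<in> \<tau>. u < v}" for v
    define g :: "nat \<Rightarrow> nat \<Rightarrow> 'a" where
      "g v w = (-1) ^ s v * ((-1) ^ card {u \<in> insert v \<tau>. u < w} * c (insert w (insert v \<tau>)))" for v w
    define P where "P = {(v,w). v \<notin> \<tau> \<and> w \<notin> \<tau> \<and> v \<noteq> w \<and> insert v (insert w \<tau>) \<in> K}"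
    have card_ins: "card {u \<in> insert v \<tau>. u < w} = s w + (if v < w then 1 else 0)" if "v \<notin> \<tau>" for v w
    proof -
      have "{u \<in> insert v \<tau>. u < w} = (if v < w then insert v {u\<in>\<tau>. u < w} else {u\<in>\<tau>. u < w})"
        by auto
      then show ?thesis using that ft by (simp add: s_def)
    qed
    have anti: "g v w + g w v = 0" if "(v,w) \<in> P" "v < w" for v w
    proof -
      have "v \<notin> \<tau>" "w \<notin> \<tau>" using that by (auto simp: P_def)
      then show ?thesis
        using that(2) unfolding g_def card_ins[OF \<open>v \<notin> \<tau>\<close>] card_ins[OF \<open>w \<notin> \<tau>\<close>]
        by (simp add: insert_commute algebra_simps)
    qed
    have fP: "finite P"
      by (rule finite_subset[of _ "\<Union>K \<times> \<Union>K"]) (use fU in \<open>auto simp: P_def\<close>)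
    have P1: "P = {(v,w)\<in>P. v < w} \<union> {(v,w)\<in>P. w < v}" by (auto simp: P_def)
    have "boundary K (boundary K c) \<tau> =
       (\<Sum>v\<in>{v. v \<notin> \<tau> \<and> insert v \<tau> \<in> K}. \<Sum>w\<in>{w. w \<notin> insert v \<tau> \<and> insert w (insert v \<tau>) \<in> K}. g v w)"
      using True by (simp add: boundary_def g_def s_def sum_distrib_left)
    also have "\<dots> = (\<Sum>(v,w)\<in>P. g v w)"
    proof (subst sum.Sigma)
      show "finite {v. v \<notin> \<tau> \<and> insert v \<tau> \<in> K}"
        by (rule finite_subset[OF _ fU]) auto
      show "\<forall>v\<in>{v. v \<notin> \<tau> \<and> insert v \<tau> \<in> K}. finite {w. w \<notin> insert v \<tau> \<and> insert w (insert v \<tau>) \<in> K}"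
        by (intro ballI, rule finite_subset[OF _ fU]) auto
      show "(\<Sum>(v,w)\<in>(SIGMA v:{v. v \<notin> \<tau> \<and> insert v \<tau> \<in> K}. {w. w \<notin> insert v \<tau> \<and> insert w (insert v \<tau>) \<in> K}). g v w) = (\<Sum>(v,w)\<in>P. g v w)"
        by (rule sum.cong) (auto simp: P_def insert_commute intro: down)
    qed
    also have "\<dots> = (\<Sum>(v,w)\<in>{(v,w)\<in>P. v < w}. g v w) + (\<Sum>(v,w)\<in>{(v,w)\<in>P. w < v}. g v w)"
      by (subst P1, rule sum.union_disjoint) (auto intro: finite_subset[OF _ fP])
    also have "(\<Sum>(v,w)\<in>{(v,w)\<in>P. w < v}. g v w) = (\<Sum>(v,w)\<in>{(v,w)\<in>P. v < w}. g w v)"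
      by (rule sum.reindex_bij_witness[where i="prod.swap" and j="prod.swap"])
         (auto simp: P_def insert_commute)
    also have "(\<Sum>(v,w)\<in>{(v,w)\<in>P. v < w}. g v w) + (\<Sum>(v,w)\<in>{(v,w)\<in>P. v < w}. g w v)
        = (\<Sum>(v,w)\<in>{(v,w)\<in>P. v < w}. g v w + g w v)"
      unfolding split_def by (rule sum.distrib[symmetric])
    also have "\<dots> = 0" by (rule sum.neutral) (use anti in auto)
    finally show ?thesis .
  qed
qed

lemma boundary_in_chains:
  assumes K: "abstract_complex K" and c: "c \<in> k_chains K (Suc k)"
  shows "boundary K c \<in> k_chains K k"
  unfolding k_chains_def
proof safe
  fix \<tau> assume t: "\<tau> \<notin> faces K k"
  show "boundary K c \<tau> = 0"
  proof (cases "\<tau> \<in> K")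
    case True
    then have "finite \<tau>" using K by (auto simp: abstract_complex_def)
    then have "c (insert v \<tau>) = 0" if "v \<notin> \<tau>" for v
      using c t True that by (auto simp: k_chains_def faces_def)
    then show ?thesis by (simp add: boundary_def)
  qed (simp add: boundary_def)
qed

lemma module_cycle_module:
  "module (class_ring :: 'r::comm_ring_1 ring) (cycle_module K k)"
proof (rule moduleI)
  show "cring (class_ring :: 'r ring)" 
    by (unfold_locales) (auto simp: algebra_simps Units_def intro: exI[of _ "- _"] )
  show "abelian_group (cycle_module K k :: ('r, _) module)"
  proof (rule abelian_groupI)
    fix x :: "nat set \<Rightarrow> 'r" assume x: "x \<in> carrier (cycle_module K k)"
    show "\<exists>y\<in>carrier (cycle_module K k). y \<oplus>\<^bsub>cycle_module K k\<^esub> x = \<zero>\<^bsub>cycle_module K k\<^esub>"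
      using x boundary_scale[of K "-1" x]
      by (intro bexI[of _ "\<lambda>\<sigma>. -1 * x \<sigma>"]) (auto simp: cycle_module_def k_cycles_def k_chains_def)
  qed (auto simp: cycle_module_def k_cycles_def k_chains_def boundary_add algebra_simps, simp add: boundary_def fun_eq_iff)
qed (auto simp: cycle_module_def k_cycles_def k_chains_def boundary_scale algebra_simps)

lemma module_quotient_module:
  assumes M: "module R M" and N: "N \<subseteq> carrier M" "\<zero>\<^bsub>M\<^esub> \<in> N"
    and add: "\<And>x y. x \<in> N \<Longrightarrow> y \<in> N \<Longrightarrow> x \<oplus>\<^bsub>M\<^esub> y \<in> N"
    and sm: "\<And>a x. a \<in> carrier R \<Longrightarrow> x \<in> N \<Longrightarrow> a \<odot>\<^bsub>M\<^esub> x \<in> N"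
  shows "module R (quotient_module M N)"
proof -
  interpret M: module R M by fact
  have neg: "\<ominus>\<^bsub>M\<^esub> x \<in> N" if "x \<in> N" for x
  proof -
    have "x \<in> carrier M" using that N by auto
    then have "\<ominus>\<^bsub>M\<^esub> x = (\<ominus>\<^bsub>R\<^esub> \<one>\<^bsub>R\<^esub>) \<odot>\<^bsub>M\<^esub> x"
      by (metis M.smult_l_minus M.smult_one M.R.one_closed)
    then show ?thesis using sm that by auto
  qed
  have "subgroup N (add_monoid M)"
    by (rule group.subgroupI[OF M.a_group]) (use N add neg in \<open>auto simp: a_inv_def[symmetric]\<close>)
  then interpret S: abelian_subgroup N M
    by (rule abelian_subgroupI2[OF M.a_comm_group])
  let ?Q = "quotient_module M N"
  have car: "carrier ?Q = (\<lambda>x. N +>\<^bsub>M\<^esub> x) ` carrier M"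
    by (auto simp: quotient_module_def A_RCOSETS_def RCOSETS_def a_r_coset_def)
  have addQ: "(N +>\<^bsub>M\<^esub> x) \<oplus>\<^bsub>?Q\<^esub> (N +>\<^bsub>M\<^esub> y) = N +>\<^bsub>M\<^esub> (x \<oplus>\<^bsub>M\<^esub> y)"
    if "x \<in> carrier M" "y \<in> carrier M" for x y
    using that by (simp add: quotient_module_def S.a_rcos_sum)
  have smQ: "a \<odot>\<^bsub>?Q\<^esub> (N +>\<^bsub>M\<^esub> x) = N +>\<^bsub>M\<^esub> (a \<odot>\<^bsub>M\<^esub> x)" 
    if a: "a \<in> carrier R" and x: "x \<in> carrier M" for a x
  proof -
    have eq: "N +>\<^bsub>M\<^esub> (a \<odot>\<^bsub>M\<^esub> y) = N +>\<^bsub>M\<^esub> (a \<odot>\<^bsub>M\<^esub> x)" if y: "y \<in> N +>\<^bsub>M\<^esub> x" for y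
    proof -
      obtain h where h: "h \<in> N" "y = h \<oplus>\<^bsub>M\<^esub> x" using y by (auto simp: a_r_coset_defs)
      then have "a \<odot>\<^bsub>M\<^esub> y = (a \<odot>\<^bsub>M\<^esub> h) \<oplus>\<^bsub>M\<^esub> (a \<odot>\<^bsub>M\<^esub> x)"
        using a x N by (auto simp: M.smult_r_distr)
      then have "a \<odot>\<^bsub>M\<^esub> y \<in> N +>\<^bsub>M\<^esub> (a \<odot>\<^bsub>M\<^esub> x)"
        using sm[OF a h(1)] by (auto simp: a_r_coset_defs)
      then show ?thesis
        using S.a_repr_independence'[OF _ M.smult_closed[OF a x]] by simp
    qed
    have "N +>\<^bsub>M\<^esub> x \<noteq> {}" using S.a_rcos_self[OF x] by auto
    then show ?thesis using eq by (auto simp: quotient_module_def)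
  qed
  have zQ: "\<zero>\<^bsub>?Q\<^esub> = N +>\<^bsub>M\<^esub> \<zero>\<^bsub>M\<^esub>"
    using N by (force simp: quotient_module_def a_r_coset_defs)
  show ?thesis
  proof (rule moduleI)
    show "cring R" by (rule M.R.is_cring)
    show "abelian_group ?Q"
    proof (rule abelian_groupI)
      fix x assume "x \<in> carrier ?Q"
      then obtain z where z: "z \<in> carrier M" "x = N +>\<^bsub>M\<^esub> z" by (auto simp: car)
      show "\<exists>y\<in>carrier ?Q. y \<oplus>\<^bsub>?Q\<^esub> x = \<zero>\<^bsub>?Q\<^esub>"
        by (rule bexI[of _ "N +>\<^bsub>M\<^esub> (\<ominus>\<^bsub>M\<^esub> z)"]) (use z in \<open>auto simp: car addQ zQ M.l_neg\<close>)
    qed (auto simp: car addQ zQ M.a_ac)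
  qed (auto simp: car addQ smQ M.smult_l_distr M.smult_r_distr M.smult_assoc1)
qed

lemma module_homology:
  assumes K: "abstract_complex K"
  shows "module (class_ring :: 'r::comm_ring_1 ring) (homology K k)"
  unfolding homology_def
proof (rule module_quotient_module[OF module_cycle_module])
  show "k_boundaries K k \<subseteq> carrier (cycle_module K k :: ('r,_) module)"
    using K by (auto simp: k_boundaries_def cycle_module_def k_cycles_def boundary_boundary boundary_in_chains)
  show "\<zero>\<^bsub>cycle_module K k :: ('r,_) module\<^esub> \<in> k_boundaries K k"
    unfolding k_boundaries_def
    by (rule image_eqI[of _ _ "\<lambda>_. 0"]) (auto simp: cycle_module_def k_chains_def boundary_def fun_eq_iff)
next
  fix x y :: "nat set \<Rightarrow> 'r" assume "x \<in> k_boundaries K k" "y \<in> k_boundaries K k"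
  then obtain c d where "c \<in> k_chains K (Suc k)" "d \<in> k_chains K (Suc k)" "x = boundary K c" "y = boundary K d"
    by (auto simp: k_boundaries_def)
  then show "x \<oplus>\<^bsub>cycle_module K k\<^esub> y \<in> k_boundaries K k"
    unfolding k_boundaries_def
    by (intro image_eqI[of _ _ "\<lambda>\<sigma>. c \<sigma> + d \<sigma>"]) (auto simp: cycle_module_def k_chains_def boundary_add)
next
  fix a and x :: "nat set \<Rightarrow> 'r" assume "x \<in> k_boundaries K k"
  then obtain c where "c \<in> k_chains K (Suc k)" "x = boundary K c"
    by (auto simp: k_boundaries_def)
  then show "a \<odot>\<^bsub>cycle_module K k\<^esub> x \<in> k_boundaries K k"
    unfolding k_boundaries_def
    by (intro image_eqI[of _ _ "\<lambda>\<sigma>. a * c \<sigma>"]) (auto simp: cycle_module_def k_chains_def boundary_scale)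
qed

lemma vectorspace_homology:
  assumes "abstract_complex K"
  shows "vectorspace (class_ring :: 'r::field ring) (homology K k)"
  by (intro vectorspace.intro module_homology assms class_field)

definition H1_int :: "nat set set \<Rightarrow> (int, (nat set \<Rightarrow> int) set) module" where
  "H1_int S = homology S 1"

definition H1_F2 :: "nat set set \<Rightarrow> (bit, (nat set \<Rightarrow> bit) set) module" where
  "H1_F2 S = homology S 1"

definition dim_H1_F2 :: "nat set set \<Rightarrow> nat" where
  "dim_H1_F2 S = vectorspace.dim (class_ring :: bit ring) (H1_F2 S)"

section \<open>Determinantal hypertrees\<close>

definition two_dim_complex_on :: "nat \<Rightarrow> nat set set \<Rightarrow> bool" where
  "two_dim_complex_on n S \<longleftrightarrow>
     abstract_complex S \<and> \<Union>S = {1..n} \<and>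
     (\<forall>\<sigma>\<in>S. card \<sigma> \<le> 3) \<and> (\<exists>\<sigma>\<in>S. card \<sigma> = 3)"

definition hypertrees :: "nat \<Rightarrow> nat set set set" where
  "hypertrees n =
    {S. two_dim_complex_on n S \<and>
        (\<forall>e. e \<subseteq> {1..n} \<and> card e = 2 \<longrightarrow> e \<in> S) \<and>
        card (faces S 2) = (n - 1) choose 2 \<and>
        finite (carrier (H1_int S))}"

definition determinantal_hypertree ::
  "nat \<Rightarrow> 'a measure \<Rightarrow> ('a \<Rightarrow> nat set set) \<Rightarrow> bool" where
  "determinantal_hypertree n M T \<longleftrightarrow>
     prob_space M \<and>
     T \<in> M \<rightarrow>\<^sub>M count_space (hypertrees n) \<and>
     (\<forall>S\<in>hypertrees n.
        measure M {\<omega> \<in> space M. T \<omega> = S} =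
          (real (card (carrier (H1_int S))))\<^sup>2 / real n ^ ((n - 2) choose 2))"

end

theory Submission
  imports Defs "Jordan_Normal_Form.Determinant" "HOL-Real_Asymp.Real_Asymp"
begin

text \<open>
  By Markov's inequality it suffices to show that the expectation of \<open>2 ^ dim H\<^sub>1(T\<^sub>n, F\<^sub>2)\<close> is
  \<open>exp (o(n\<^sup>2))\<close>. This power is at most the number of sign functions \<open>s\<close> on the edges (1-cochains
  modulo 2) whose product over each triangle of \<open>T\<^sub>n\<close> is 1. For fixed \<open>s\<close> let \<open>X\<close> be the set of
  triangles with sign 1. Since \<open>|H\<^sub>1(S, Z)|\<close> is at most a maximal minor of the incidence
  matrix with the edges at vertex 1 removed, Cauchy--Binet and Hadamard's inequality bound the sum
  of \<open>|H\<^sub>1(S, Z)|\<^sup>2\<close> over the hypertrees \<open>S \<subseteq> X\<close> by the product of the degrees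
  \<open>deg\<^sub>X(e) \<le> n/2 (1 + s(e) c\<^sub>s(e))\<close>, where \<open>c\<^sub>s(u, v)\<close> is the average of
  \<open>s(u, w) s(v, w)\<close> over all \<open>w\<close>. It remains to bound the sum over \<open>s\<close> of the products of
  \<open>1 + s(e) c\<^sub>s(e)\<close>.

  If \<open>c\<close> did not depend on \<open>s\<close>, this sum would factorise and equal the number of sign
  functions. A random sample of \<open>k\<close> vertices \<open>w\<close> approximates \<open>c\<^sub>s\<close> with average error
  \<open>1 / sqrt k\<close>, and the approximation takes at most \<open>2 ^ (n k)\<close> values. A union bound over
  these values therefore costs only a factor \<open>exp (o(n\<^sup>2))\<close>.
\<close>

section \<open>Sampling and sums over sign functions\<close>

text \<open>The second moment of a sum of \<open>k\<close> independent uniform samples, as a count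
  over all sample functions \<open>f\<close>. Off-diagonal terms of the expanded square vanish
  because \<open>b\<close> is centred; a diagonal term leaves \<open>k - 1\<close> coordinates
  free.\<close>

lemma sum_PiE_square_centered:
  fixes b :: "'w \<Rightarrow> real"
  assumes W: "finite W" and c: "(\<Sum>w\<in>W. b w) = 0"
  shows "(\<Sum>f\<in>PiE {..<k} (\<lambda>_. W). (\<Sum>j<k. b (f j))\<^sup>2) =
    real k * real (card W) ^ (k - 1) * (\<Sum>w\<in>W. (b w)\<^sup>2)"
proof -
  let ?F = "PiE {..<k} (\<lambda>_. W)"
  have mixed: "(\<Sum>f\<in>?F. b (f i) * b (f j)) =
      (if i = j then real (card W) ^ (k - 1) * (\<Sum>w\<in>W. (b w)\<^sup>2) else 0)"
    if i: "i < k" and j: "j < k" for i j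
  proof -
    \<comment> \<open>All factors are 1 away from the coordinates \<open>i\<close> and
      \<open>j\<close>, which puts the mixed moment into the product form required by
      \<open>prod_sum_PiE\<close>.\<close>
    define g where "g l w = (if l = i then b w else 1) * (if l = j then b w else 1)" for l w
    have "(\<Prod>l<k. g l (f l)) = b (f i) * b (f j)" for f
      using i j by (simp add: g_def prod.distrib)
    then have "(\<Sum>f\<in>?F. b (f i) * b (f j)) = (\<Prod>l<k. \<Sum>w\<in>W. g l w)"
      using W by (subst prod_sum_PiE) auto
    also have "\<dots> = (\<Sum>w\<in>W. g i w) * (\<Prod>l\<in>{..<k}-{i}. \<Sum>w\<in>W. g l w)"
      using i by (subst prod.remove[of _ i]) auto
    also have "\<dots> = (if i = j then real (card W) ^ (k - 1) * (\<Sum>w\<in>W. (b w)\<^sup>2) else 0)"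
    proof (cases "i = j")
      case True
      have "(\<Prod>l\<in>{..<k}-{i}. \<Sum>w\<in>W. g l w) = (\<Prod>l\<in>{..<k}-{i}. real (card W))"
        using True by (intro prod.cong) (auto simp: g_def)
      then show ?thesis using True i by (simp add: g_def power2_eq_square)
    next
      case False
      then show ?thesis using c by (simp add: g_def)
    qed
    finally show ?thesis .
  qed
  have "(\<Sum>f\<in>?F. (\<Sum>j<k. b (f j))\<^sup>2) = (\<Sum>f\<in>?F. \<Sum>i<k. \<Sum>j<k. b (f i) * b (f j))"
    by (simp add: power2_eq_square sum_product)
  also have "\<dots> = (\<Sum>i<k. \<Sum>j<k. \<Sum>f\<in>?F. b (f i) * b (f j))"
    by (simp add: sum.swap[of _ ?F])
  also have "\<dots> = (\<Sum>i<k. \<Sum>j<k. if i = j then real (card W) ^ (k - 1) * (\<Sum>w\<in>W. (b w)\<^sup>2) else 0)"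
    by (intro sum.cong refl) (simp add: mixed)
  finally show ?thesis by simp
qed

text \<open>Under a uniformly random \<open>f\<close> each empirical mean has variance at most
  \<open>1 / k\<close>. Averaging the total error over \<open>f\<close> therefore yields one sample
  that serves all \<open>e\<close> at once, with the errors summed.\<close>

lemma sampling_L1:
  fixes a :: "'e \<Rightarrow> 'w \<Rightarrow> real" and k :: nat
  assumes W: "finite W" "W \<noteq> {}" and E: "finite E" and k: "k > 0"
    and a: "\<And>e w. e \<in> E \<Longrightarrow> w \<in> W \<Longrightarrow> \<bar>a e w\<bar> \<le> 1"
  obtains f where "f \<in> PiE {..<k} (\<lambda>_. W)"
    "(\<Sum>e\<in>E. \<bar>(\<Sum>w\<in>W. a e w) / card W - (\<Sum>j<k. a e (f j)) / k\<bar>) \<le> card E / sqrt k"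
proof -
  let ?F = "PiE {..<k} (\<lambda>_. W)"
  define x where "x e f = (\<Sum>w\<in>W. a e w) / card W - (\<Sum>j<k. a e (f j)) / k" for e f
  have N: "card W > 0" using W by (simp add: card_gt_0_iff)
  have cF: "card ?F = card W ^ k" by (simp add: card_PiE)
  have sq: "(\<Sum>f\<in>?F. (x e f)\<^sup>2) \<le> card ?F / k" if e: "e \<in> E" for e
  proof -
    define \<mu> where "\<mu> = (\<Sum>w\<in>W. a e w) / card W"
    define b where "b w = a e w - \<mu>" for w
    have c: "(\<Sum>w\<in>W. b w) = 0" using N by (simp add: b_def sum_subtractf \<mu>_def)
    have s: "(\<Sum>w\<in>W. a e w) = card W * \<mu>" using N by (simp add: \<mu>_def)
    have "(\<Sum>w\<in>W. (b w)\<^sup>2) = (\<Sum>w\<in>W. (a e w)\<^sup>2 - 2 * \<mu> * a e w + \<mu>\<^sup>2)"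
      by (simp add: b_def power2_diff algebra_simps)
    also have "\<dots> = (\<Sum>w\<in>W. (a e w)\<^sup>2) - card W * \<mu>\<^sup>2"
      by (simp add: sum.distrib sum_subtractf sum_distrib_left[symmetric] s power2_eq_square)
    also have "\<dots> \<le> (\<Sum>w\<in>W. 1)"
    proof -
      have "(\<Sum>w\<in>W. (a e w)\<^sup>2) \<le> (\<Sum>w\<in>W. 1)"
        using a[OF e] by (intro sum_mono) (simp add: abs_square_le_1)
      moreover have "0 \<le> card W * \<mu>\<^sup>2" by simp
      ultimately show ?thesis by linarith
    qed
    finally have var: "(\<Sum>w\<in>W. (b w)\<^sup>2) \<le> card W" by simp
    have "x e f = - (\<Sum>j<k. b (f j)) / k" for f
      using k by (simp add: x_def b_def sum_subtractf \<mu>_def[symmetric] field_simps)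
    then have "(\<Sum>f\<in>?F. (x e f)\<^sup>2) = (\<Sum>f\<in>?F. (\<Sum>j<k. b (f j))\<^sup>2) / k\<^sup>2"
      by (simp only: power_divide power2_minus sum_divide_distrib of_nat_power)
    also have "\<dots> = real (card W) ^ (k - 1) * (\<Sum>w\<in>W. (b w)\<^sup>2) / k"
      unfolding sum_PiE_square_centered[OF W(1) c] using k by (simp add: power2_eq_square)
    also have "\<dots> \<le> real (card W) ^ (k - 1) * card W / k"
      using var by (intro divide_right_mono mult_left_mono) auto
    also have "\<dots> = card ?F / k"
      unfolding cF using k by (cases k) simp_all
    finally show ?thesis .
  qed
  \<comment> \<open>Takes the place of Cauchy--Schwarz: the absolute value is dominated by a linear
    function of the square, balanced so that both summands agree when the mean square is
    \<open>1 / k\<close>.\<close>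
  have am_gm: "\<bar>y\<bar> \<le> (sqrt k * y\<^sup>2 + 1 / sqrt k) / 2" for y :: real
  proof -
    have "0 \<le> (sqrt k * \<bar>y\<bar> - 1)\<^sup>2" by simp
    then have "2 * (sqrt k * \<bar>y\<bar>) \<le> sqrt k * (sqrt k * y\<^sup>2) + 1"
      using k by (simp add: power2_diff power_mult_distrib flip: mult.assoc)
    then show ?thesis using k by (simp add: field_simps)
  qed
  have "(\<Sum>f\<in>?F. \<Sum>e\<in>E. \<bar>x e f\<bar>) \<le> (\<Sum>f\<in>?F. \<Sum>e\<in>E. (sqrt k * (x e f)\<^sup>2 + 1 / sqrt k) / 2)"
    by (intro sum_mono am_gm)
  also have "\<dots> = (\<Sum>e\<in>E. (sqrt k * (\<Sum>f\<in>?F. (x e f)\<^sup>2) + card ?F / sqrt k) / 2)"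
    by (subst sum.swap) (simp add: sum_divide_distrib[symmetric] sum.distrib sum_distrib_left)
  also have "\<dots> \<le> (\<Sum>e\<in>E. (sqrt k * (card ?F / k) + card ?F / sqrt k) / 2)"
    using sq by (intro sum_mono divide_right_mono add_right_mono mult_left_mono) auto
  also have "\<dots> = (\<Sum>f\<in>?F. card E / sqrt k)"
  proof -
    have "sqrt k * (card ?F / k) = card ?F / sqrt k"
      using k by (simp add: field_simps)
    then show ?thesis by simp
  qed
  finally have le: "(\<Sum>f\<in>?F. \<Sum>e\<in>E. \<bar>x e f\<bar>) \<le> (\<Sum>f\<in>?F. card E / sqrt k)" .
  have "\<exists>f\<in>?F. (\<Sum>e\<in>E. \<bar>x e f\<bar>) \<le> card E / sqrt k"
  proof (rule ccontr)
    assume "\<not> ?thesis"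
    then have "(\<Sum>f\<in>?F. card E / sqrt k) < (\<Sum>f\<in>?F. \<Sum>e\<in>E. \<bar>x e f\<bar>)"
      using W by (intro sum_strict_mono finite_PiE) (auto simp: PiE_eq_empty_iff not_le)
    then show False using le by simp
  qed
  then show thesis using that by (auto simp: x_def)
qed

text \<open>Cochains modulo 2 in multiplicative form. Extensionality makes the set finite for finite
  \<open>E\<close> and lets products over \<open>E\<close> be expanded by
  \<open>prod_sum_PiE\<close>.\<close>

definition sign_functions :: "'e set \<Rightarrow> ('e \<Rightarrow> real) set" where
  "sign_functions E = (E \<rightarrow>\<^sub>E {-1, 1})"

lemma card_sign_functions: "finite E \<Longrightarrow> card (sign_functions E) = 2 ^ card E"
  by (simp add: sign_functions_def card_PiE flip: numeral_2_eq_2)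

lemma finite_sign_functions: "finite E \<Longrightarrow> finite (sign_functions E)"
  by (simp add: sign_functions_def finite_PiE)

text \<open>Because \<open>c\<close> does not depend on \<open>s\<close>, the sum factorises over
  coordinates: the two signs at \<open>e\<close> contribute \<open>(b - c e) + (b + c e)\<close>,
  and a coordinate outside \<open>E'\<close> contributes 2.\<close>

lemma sum_sign_functions_prod:
  assumes E: "finite E" and E': "E' \<subseteq> E"
  shows "(\<Sum>s\<in>sign_functions E. \<Prod>e\<in>E'. b + s e * c e) = 2 ^ card E * b ^ card E'"
proof -
  have fE': "finite E'" using E E' finite_subset by blast
  define g where "g e y = (if e \<in> E' then b + y * c e else 1)" for e and y :: real
  have "(\<Prod>e\<in>E'. b + s e * c e) = (\<Prod>e\<in>E. g e (s e))" for s
    using E E' by (intro prod.mono_neutral_cong_left) (auto simp: g_def)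
  then have "(\<Sum>s\<in>sign_functions E. \<Prod>e\<in>E'. b + s e * c e) = (\<Prod>e\<in>E. \<Sum>y\<in>{-1,1}. g e y)"
    unfolding sign_functions_def using E by (subst prod_sum_PiE) auto
  also have "\<dots> = (\<Prod>e\<in>E. 2 * (if e \<in> E' then b else 1))"
    by (intro prod.cong) (auto simp: g_def)
  also have "\<dots> = 2 ^ card E * (\<Prod>e\<in>E. (if e \<in> E' then b else 1))"
    by (simp add: prod.distrib)
  also have "(\<Prod>e\<in>E. (if e \<in> E' then b else 1)) = (\<Prod>e\<in>E'. b)"
    using E E' by (intro prod.mono_neutral_cong_right) auto
  finally show ?thesis by simp
qed

text \<open>Setting the sign of a degenerate edge to \<open>1\<close> makes the products below meaningful for
  \<open>w \<in> e\<close> as well.\<close>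

definition edge_sign :: "('v set \<Rightarrow> real) \<Rightarrow> 'v \<Rightarrow> 'v \<Rightarrow> real" where
  "edge_sign s u w = (if u = w then 1 else s {u, w})"

definition link_sign :: "('v set \<Rightarrow> real) \<Rightarrow> 'v set \<Rightarrow> 'v \<Rightarrow> real" where
  "link_sign s e w = (\<Prod>u\<in>e. edge_sign s u w)"

definition edges_on :: "'v set \<Rightarrow> 'v set set" where
  "edges_on V = {e. e \<subseteq> V \<and> card e = 2}"

lemma finite_edges_on: "finite V \<Longrightarrow> finite (edges_on V)"
  unfolding edges_on_def by (rule finite_subset[of _ "Pow V"]) auto

lemma edge_sign_values:
  assumes "s \<in> sign_functions (edges_on V)" "u \<in> V" "w \<in> V"
  shows "edge_sign s u w \<in> {-1, 1}"
  using assms by (auto simp: edge_sign_def sign_functions_def edges_on_def PiE_iff)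

lemma link_sign_values:
  assumes s: "s \<in> sign_functions (edges_on V)" and e: "e \<in> edges_on V" and w: "w \<in> V"
  shows "link_sign s e w \<in> {-1, 1}"
proof -
  obtain u v where e: "e = {u, v}" "u \<noteq> v" "u \<in> V" "v \<in> V"
    using e by (auto simp: edges_on_def card_2_iff)
  then show ?thesis
    using edge_sign_values[OF s _ w, of u] edge_sign_values[OF s _ w, of v]
    by (auto simp: link_sign_def)
qed

text \<open>The shift by \<open>\<eta>\<close> keeps the denominator away from 0: the ratio of
  \<open>x e\<close> to \<open>y e + \<eta>\<close> is at most
  \<open>1 + \<bar>x e - y e\<bar> / \<eta>\<close>, and \<open>1 + t \<le> exp t\<close>. Only the
  summed error enters, which is what \<open>sampling_L1\<close> controls.\<close>

lemma prod_perturbation: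
  fixes x y :: "'e \<Rightarrow> real"
  assumes \<eta>: "\<eta> > 0" and y: "\<And>e. e \<in> E \<Longrightarrow> y e \<ge> 0" and x: "\<And>e. e \<in> E \<Longrightarrow> x e \<ge> 0"
  shows "(\<Prod>e\<in>E. x e) \<le> exp ((\<Sum>e\<in>E. \<bar>x e - y e\<bar>) / \<eta>) * (\<Prod>e\<in>E. y e + \<eta>)"
proof (cases "finite E")
  case True
  have "x e \<le> exp (\<bar>x e - y e\<bar> / \<eta>) * (y e + \<eta>)" if e: "e \<in> E" for e
  proof -
    have "x e \<le> (1 + \<bar>x e - y e\<bar> / \<eta>) * (y e + \<eta>)"
    proof -
      have "(1 + \<bar>x e - y e\<bar> / \<eta>) * (y e + \<eta>) =
          y e + \<eta> + \<bar>x e - y e\<bar> + \<bar>x e - y e\<bar> / \<eta> * y e"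
        using \<eta> by (simp add: field_simps)
      moreover have "0 \<le> \<bar>x e - y e\<bar> / \<eta> * y e" using y[OF e] \<eta> by simp
      ultimately show ?thesis using \<eta> by linarith
    qed
    also have "\<dots> \<le> exp (\<bar>x e - y e\<bar> / \<eta>) * (y e + \<eta>)"
      using y[OF e] \<eta> by (intro mult_right_mono exp_ge_add_one_self) auto
    finally show ?thesis .
  qed
  then have "(\<Prod>e\<in>E. x e) \<le> (\<Prod>e\<in>E. exp (\<bar>x e - y e\<bar> / \<eta>) * (y e + \<eta>))"
    using x by (intro prod_mono) auto
  then show ?thesis
    using True by (simp add: prod.distrib exp_sum sum_divide_distrib)
qed auto

text \<open>The average over \<open>w\<close> depends on \<open>s\<close>, so
  \<open>sum_sign_functions_prod\<close> does not apply directly. A sampled average depends on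
  \<open>s\<close> only through a table \<open>t\<close> of signs; bounding by the sum over all
  tables removes this dependence, and for fixed \<open>t\<close> the sum over \<open>s\<close>
  factorises.\<close>

lemma sum_prod_link_signs_le:
  assumes V: "finite V" "V \<noteq> {}" and E': "E' \<subseteq> edges_on V" and q: "q > (0::nat)"
  shows "(\<Sum>s\<in>sign_functions (edges_on V).
            \<Prod>e\<in>E'. 1 + s e * ((\<Sum>w\<in>V. link_sign s e w) / card V)) \<le>
    2 ^ (card V * q ^ 4) * 2 ^ card (edges_on V) * exp (2 * card E' / q)"
proof -
  \<comment> \<open>With \<open>q ^ 4\<close> samples the summed error is at most
    \<open>card E' / q ^ 2\<close>. Dividing by \<open>\<eta>\<close> turns this into the exponent
    \<open>card E' / q\<close>; the shift by \<open>\<eta>\<close> costs the same again, whence the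
    2 in the final exponent.\<close>
  define k where "k = q ^ 4"
  define \<eta> where "\<eta> = 1 / real q"
  let ?E = "edges_on V"
  let ?T = "sign_functions (V \<times> {..<k})"
  define c where "c s e = (\<Sum>w\<in>V. link_sign s e w) / card V" for s e
  define C where "C t e = (\<Sum>j<k. \<Prod>u\<in>e. t (u, j)) / k" for t :: "'a \<times> nat \<Rightarrow> real" and e
  have k: "k > 0" and \<eta>: "\<eta> > 0" using q by (auto simp: k_def \<eta>_def)
  have sqk: "sqrt k = q ^ 2"
    by (rule real_sqrt_unique) (auto simp: k_def)
  have fE: "finite ?E" using V finite_edges_on by auto
  have fE': "finite E'" using finite_subset[OF E' fE] .
  have fT: "finite ?T" using V by (auto intro: finite_sign_functions)
  have s_abs: "s e \<in> {-1,1}" if "s \<in> sign_functions ?E" "e \<in> E'" for s e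
    using that E' by (auto simp: sign_functions_def PiE_iff)
  have c_abs: "\<bar>c s e\<bar> \<le> 1" if s: "s \<in> sign_functions ?E" and e: "e \<in> E'" for s e
  proof -
    have "\<bar>\<Sum>w\<in>V. link_sign s e w\<bar> \<le> (\<Sum>w\<in>V. 1)"
      using link_sign_values[OF s] e E' by (intro order.trans[OF sum_abs] sum_mono) fastforce
    then show ?thesis using V by (simp add: c_def abs_divide divide_le_eq card_gt_0_iff)
  qed
  have C_abs: "\<bar>C t e\<bar> \<le> 1" if t: "t \<in> ?T" and e: "e \<in> E'" for t e
  proof -
    have "\<bar>\<Prod>u\<in>e. t (u, j)\<bar> \<le> 1" if "j < k" for j
    proof -
      have "\<bar>t (u, j)\<bar> = 1" if "u \<in> e" for u
      proof -
        have "(u, j) \<in> V \<times> {..<k}" using e E' that \<open>j < k\<close> by (auto simp: edges_on_def)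
        then have "t (u, j) \<in> {-1, 1}" using t unfolding sign_functions_def by (rule PiE_mem[rotated])
        then show ?thesis by auto
      qed
      then show ?thesis by (simp add: abs_prod)
    qed
    then have "\<bar>\<Sum>j<k. \<Prod>u\<in>e. t (u, j)\<bar> \<le> (\<Sum>j<k. 1)"
      by (intro order.trans[OF sum_abs] sum_mono) auto
    then show ?thesis using k by (simp add: C_def abs_divide divide_le_eq)
  qed
  have nonneg: "0 \<le> 1 + a * b" if "a \<in> {-1,1}" "\<bar>b\<bar> \<le> 1" for a b :: real
    using that by auto
  have pt: "(\<Prod>e\<in>E'. 1 + s e * c s e) \<le>
      (\<Sum>t\<in>?T. exp (card E' / q) * (\<Prod>e\<in>E'. (1 + \<eta>) + s e * C t e))"
    if s: "s \<in> sign_functions ?E" for s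
  proof -
    have "\<bar>link_sign s e w\<bar> \<le> 1" if "e \<in> E'" "w \<in> V" for e w
      using link_sign_values[OF s subsetD[OF E'], of e w] that by auto
    then obtain f where f: "f \<in> PiE {..<k} (\<lambda>_. V)"
      and le: "(\<Sum>e\<in>E'. \<bar>c s e - (\<Sum>j<k. link_sign s e (f j)) / k\<bar>) \<le> card E' / sqrt k"
      using sampling_L1[OF V fE' k, of "link_sign s"] unfolding c_def by blast
    \<comment> \<open>Column \<open>j\<close> of the table lists the signs between all vertices and
      the sampled vertex \<open>f j\<close>, so \<open>C t\<close> is the sampled average of link
      signs.\<close>
    define t where "t = restrict (\<lambda>(u, j). edge_sign s u (f j)) (V \<times> {..<k})"
    have t: "t \<in> ?T"
      using edge_sign_values[OF s] f unfolding t_def sign_functions_def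
      by (intro restrict_PiE_iff[THEN iffD2] ballI) (auto simp: PiE_iff)
    have Ct: "C t e = (\<Sum>j<k. link_sign s e (f j)) / k" if "e \<in> E'" for e
      using that E' by (force simp: C_def t_def link_sign_def edges_on_def
          intro!: sum.cong prod.cong arg_cong2[where f = "(/)"])
    have "(\<Prod>e\<in>E'. 1 + s e * c s e) \<le>
      exp ((\<Sum>e\<in>E'. \<bar>(1 + s e * c s e) - (1 + s e * C t e)\<bar>) / \<eta>) *
      (\<Prod>e\<in>E'. 1 + s e * C t e + \<eta>)"
      using s t by (intro prod_perturbation \<eta> nonneg s_abs C_abs c_abs)
    also have "\<dots> \<le> exp (card E' / q) * (\<Prod>e\<in>E'. 1 + s e * C t e + \<eta>)"
    proof (intro mult_right_mono prod_nonneg)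
      have "(\<Sum>e\<in>E'. \<bar>(1 + s e * c s e) - (1 + s e * C t e)\<bar>) =
          (\<Sum>e\<in>E'. \<bar>c s e - (\<Sum>j<k. link_sign s e (f j)) / k\<bar>)"
        using s_abs[OF s] by (intro sum.cong) (force simp: Ct)+
      then have "(\<Sum>e\<in>E'. \<bar>(1 + s e * c s e) - (1 + s e * C t e)\<bar>) / \<eta> \<le> card E' / sqrt k / \<eta>"
        using le \<eta> by (intro divide_right_mono) auto
      also have "\<dots> = card E' / q"
        using q by (simp add: sqk \<eta>_def power2_eq_square)
      finally show "exp ((\<Sum>e\<in>E'. \<bar>(1 + s e * c s e) - (1 + s e * C t e)\<bar>) / \<eta>) \<le> exp (card E' / q)"
        by simp
    next
      fix e assume "e \<in> E'"
      then show "0 \<le> 1 + s e * C t e + \<eta>"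
        using nonneg[OF s_abs[OF s] C_abs[OF t], of e e] \<eta> by simp
    qed
    also have "\<dots> = exp (card E' / q) * (\<Prod>e\<in>E'. (1 + \<eta>) + s e * C t e)"
      by (simp add: algebra_simps)
    \<comment> \<open>The table built from \<open>f\<close> is one of all tables, and every term is
      nonnegative. The new bound involves no choice made for this \<open>s\<close>, so the two sums
      can be exchanged.\<close>
    also have "\<dots> \<le> (\<Sum>t\<in>?T. exp (card E' / q) * (\<Prod>e\<in>E'. (1 + \<eta>) + s e * C t e))"
    proof (rule member_le_sum[OF t _ fT])
      fix t' assume "t' \<in> ?T - {t}"
      then have t': "t' \<in> ?T" by simp
      have "0 \<le> 1 + \<eta> + s e * C t' e" if "e \<in> E'" for e
        using nonneg[OF s_abs[OF s that] C_abs[OF t' that]] \<eta> by simp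
      then show "0 \<le> exp (card E' / q) * (\<Prod>e\<in>E'. (1 + \<eta>) + s e * C t' e)"
        by (intro mult_nonneg_nonneg prod_nonneg) auto
    qed
    finally show ?thesis .
  qed
  have "(\<Sum>s\<in>sign_functions ?E. \<Prod>e\<in>E'. 1 + s e * c s e) \<le>
      (\<Sum>s\<in>sign_functions ?E. \<Sum>t\<in>?T. exp (card E' / q) * (\<Prod>e\<in>E'. (1 + \<eta>) + s e * C t e))"
    by (intro sum_mono pt)
  also have "\<dots> = (\<Sum>t\<in>?T. exp (card E' / q) * (2 ^ card ?E * (1 + \<eta>) ^ card E'))"
    by (subst sum.swap) (simp add: sum_distrib_left[symmetric] sum_sign_functions_prod[OF fE E'])
  also have "\<dots> = 2 ^ (card V * k) * (exp (card E' / q) * (2 ^ card ?E * (1 + \<eta>) ^ card E'))"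
    using V by (simp add: card_sign_functions card_cartesian_product)
  also have "\<dots> \<le> 2 ^ (card V * k) * (exp (card E' / q) * (2 ^ card ?E * exp (card E' / q)))"
  proof -
    have "(1 + \<eta>) ^ card E' \<le> exp \<eta> ^ card E'"
      using \<eta> by (intro power_mono exp_ge_add_one_self) auto
    also have "\<dots> = exp (card E' / q)"
      by (simp add: exp_of_nat_mult[symmetric] \<eta>_def)
    finally show ?thesis by (intro mult_left_mono) auto
  qed
  also have "\<dots> = 2 ^ (card V * q ^ 4) * 2 ^ card ?E * exp (2 * card E' / q)"
    by (simp add: k_def exp_add[symmetric] field_simps flip: mult_2)
  finally show ?thesis by (simp add: c_def)
qed

section \<open>Sums of squared minors\<close>

lemma lower_unitriangular_det:
  assumes "U \<in> carrier_mat m m" "\<And>i j. i < j \<Longrightarrow> j < m \<Longrightarrow> U $$ (i, j) = 0"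
    and "\<And>i. i < m \<Longrightarrow> U $$ (i, i) = 1"
  shows "det U = (1 :: 'a :: comm_ring_1)"
  using assms by (simp add: det_lower_triangular[of m] prod_list_diag_prod)

text \<open>Gram--Schmidt without normalisation, for the inner product over \<open>X\<close>.
  Linearly dependent rows are allowed: a vector that vanishes on \<open>X\<close> gets coefficient 0
  because division by 0 gives 0.\<close>

fun orthogonalized :: "'x set \<Rightarrow> (nat \<Rightarrow> 'x \<Rightarrow> real) \<Rightarrow> nat \<Rightarrow> 'x \<Rightarrow> real" where
  "orthogonalized X r i x = r i x - (\<Sum>j<i.
     (\<Sum>y\<in>X. r i y * orthogonalized X r j y) / (\<Sum>y\<in>X. (orthogonalized X r j y)\<^sup>2)
       * orthogonalized X r j x)"

declare orthogonalized.simps [simp del]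

context
  fixes X :: "'x set" and r :: "nat \<Rightarrow> 'x \<Rightarrow> real"
  assumes X: "finite X"
begin

private abbreviation "h \<equiv> orthogonalized X r"
private abbreviation "ip f g \<equiv> (\<Sum>y\<in>X. f y * g y)"
private abbreviation "coef i j \<equiv> ip (r i) (h j) / (\<Sum>y\<in>X. (h j y)\<^sup>2)"

lemma orthogonalized_decomp: "r i x = h i x + (\<Sum>j<i. coef i j * h j x)"
  by (simp add: orthogonalized.simps[of X r i])

lemma orthogonalized_orthogonal_less: "j < i \<Longrightarrow> (\<Sum>y\<in>X. h i y * h j y) = 0"
proof (induction i arbitrary: j rule: less_induct)
  case (less i)
  define c where "c l = coef i l" for l
  have "h i y = r i y - (\<Sum>l<i. c l * h l y)" for y
    unfolding c_def by (rule orthogonalized.simps)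
  then have "ip (h i) (h j) = ip (r i) (h j) - (\<Sum>y\<in>X. \<Sum>l<i. c l * (h l y * h j y))"
    by (simp add: left_diff_distrib sum_subtractf sum_distrib_right mult.assoc)
  also have "(\<Sum>y\<in>X. \<Sum>l<i. c l * (h l y * h j y)) = (\<Sum>l<i. c l * ip (h l) (h j))"
    by (subst sum.swap) (simp add: sum_distrib_left)
  also have "\<dots> = (\<Sum>l<i. if l = j then c j * ip (h j) (h j) else 0)"
  proof (intro sum.cong refl)
    fix l assume "l \<in> {..<i}"
    then have l: "l < i" by simp
    show "c l * ip (h l) (h j) = (if l = j then c j * ip (h j) (h j) else 0)"
    proof (cases l j rule: linorder_cases)
      case less': less
      have "ip (h l) (h j) = ip (h j) (h l)" by (simp add: mult.commute)
      then show ?thesis using less.IH[OF less.prems less'] less' by simp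
    next
      case greater
      then show ?thesis using less.IH[OF l greater] by simp
    qed simp
  qed
  also have "\<dots> = c j * ip (h j) (h j)" using less.prems by simp
  \<comment> \<open>If \<open>h j\<close> vanishes on \<open>X\<close>, both sides are 0; otherwise
    the norm in the denominator of \<open>c j\<close> cancels.\<close>
  also have "\<dots> = ip (r i) (h j)"
  proof (cases "ip (h j) (h j) = 0")
    case True
    then have "\<And>y. y \<in> X \<Longrightarrow> h j y = 0"
      using X by (subst (asm) sum_nonneg_eq_0_iff) auto
    then show ?thesis by (simp add: c_def)
  qed (simp add: power2_eq_square c_def)
  finally show ?case by simp
qed

lemma orthogonalized_orthogonal: "i \<noteq> j \<Longrightarrow> (\<Sum>y\<in>X. h i y * h j y) = 0"
  using orthogonalized_orthogonal_less[of i j] orthogonalized_orthogonal_less[of j i]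
  by (cases i j rule: linorder_cases) (auto simp: mult.commute)

text \<open>Pythagoras: \<open>r i\<close> is the sum of \<open>h i\<close> and a vector
  \<open>p\<close> orthogonal to it over \<open>X\<close>.\<close>

lemma orthogonalized_norm_le: "(\<Sum>y\<in>X. (h i y)\<^sup>2) \<le> (\<Sum>y\<in>X. (r i y)\<^sup>2)"
proof -
  define c where "c j = coef i j" for j
  define p where "p y = (\<Sum>j<i. c j * h j y)" for y
  have "ip (h i) p = (\<Sum>y\<in>X. \<Sum>j<i. c j * (h i y * h j y))"
    by (simp add: p_def sum_distrib_left mult_ac)
  also have "\<dots> = (\<Sum>j<i. c j * ip (h i) (h j))"
    by (subst sum.swap) (simp add: sum_distrib_left)
  also have "\<dots> = 0"
    by (intro sum.neutral) (simp add: orthogonalized_orthogonal_less)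
  finally have "ip (h i) p = 0" .
  moreover have "r i y = h i y + p y" for y
    unfolding p_def c_def by (rule orthogonalized_decomp)
  then have "(\<Sum>y\<in>X. (r i y)\<^sup>2) = (\<Sum>y\<in>X. (h i y)\<^sup>2) + 2 * ip (h i) p + (\<Sum>y\<in>X. (p y)\<^sup>2)"
    by (simp add: power2_sum sum.distrib
        sum_distrib_left mult_ac)
  moreover have "0 \<le> (\<Sum>y\<in>X. (p y)\<^sup>2)" by (simp add: sum_nonneg)
  ultimately show ?thesis by linarith
qed

text \<open>The two matrices differ by a unitriangular factor \<open>U\<close> that is the same for
  every choice of columns \<open>\<phi>\<close>, so all maximal minors survive the
  orthogonalisation.\<close>

lemma orthogonalized_det:
  "det (mat m m (\<lambda>(i, j). r i (\<phi> j))) = det (mat m m (\<lambda>(i, j). h i (\<phi> j)))"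
proof -
  define U where "U = mat m m (\<lambda>(i, j). if j < i then coef i j else if i = j then 1 else 0)"
  define H where "H = mat m m (\<lambda>(i, j). h i (\<phi> j))"
  have U: "U \<in> carrier_mat m m" and H: "H \<in> carrier_mat m m" by (simp_all add: U_def H_def)
  have "mat m m (\<lambda>(i, j). r i (\<phi> j)) = U * H"
  proof (rule eq_matI)
    fix i j assume "i < dim_row (U * H)" "j < dim_col (U * H)"
    then have i: "i < m" and j: "j < m" by (simp_all add: U_def H_def)
    have "(U * H) $$ (i, j) = (\<Sum>l<m. U $$ (i, l) * h l (\<phi> j))"
      using i j by (simp add: U_def H_def scalar_prod_def atLeast0LessThan)
    also have "\<dots> = (\<Sum>l\<in>insert i {..<i}. (if l < i then coef i l else 1) * h l (\<phi> j))"
      using i by (intro sum.mono_neutral_cong_right) (auto simp: U_def)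
    also have "\<dots> = r i (\<phi> j)"
      by (subst orthogonalized_decomp[of i "\<phi> j"]) simp
    finally show "mat m m (\<lambda>(i, j). r i (\<phi> j)) $$ (i, j) = (U * H) $$ (i, j)"
      using i j by simp
  qed (simp_all add: U_def H_def)
  moreover have "det U = 1"
    using U by (rule lower_unitriangular_det) (simp_all add: U_def)
  ultimately show ?thesis
    using det_mult[OF U H] by (simp add: H_def)
qed

end

text \<open>Summing over functions \<open>\<phi>\<close> instead of column sets lets the double sum
  over permutations factorise column by column; for \<open>p \<noteq> p'\<close> some factor is an
  inner product of distinct rows. Non-injective \<open>\<phi>\<close> have determinant 0 and every
  column set occurs \<open>fact m\<close> times, so this is Cauchy--Binet for orthogonal
  rows.\<close>

lemma sum_det_square_orthogonal:
  fixes h :: "nat \<Rightarrow> 'x \<Rightarrow> real"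
  assumes X: "finite X"
    and orth: "\<And>i j. i < m \<Longrightarrow> j < m \<Longrightarrow> i \<noteq> j \<Longrightarrow> (\<Sum>x\<in>X. h i x * h j x) = 0"
  shows "(\<Sum>\<phi>\<in>{..<m} \<rightarrow>\<^sub>E X. (det (mat m m (\<lambda>(i, j). h i (\<phi> j))))\<^sup>2) =
    fact m * (\<Prod>i<m. \<Sum>x\<in>X. (h i x)\<^sup>2)"
proof -
  let ?P = "{p. p permutes {0..<m}}"
  let ?F = "{..<m} \<rightarrow>\<^sub>E X"
  have fP: "finite ?P" by (simp add: finite_permutations)
  have pm: "p j < m" if "p \<in> ?P" "j < m" for p j
    using that permutes_in_image[of p "{0..<m}" j] by auto
  have det: "det (mat m m (\<lambda>(i, j). h i (\<phi> j))) = (\<Sum>p\<in>?P. signof p * (\<Prod>j<m. h (p j) (\<phi> j)))" for \<phi>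
    by (subst det_col[of _ m]) (auto intro!: sum.cong prod.cong simp: pm)
  have pair: "(\<Sum>\<phi>\<in>?F. (signof p * (\<Prod>j<m. h (p j) (\<phi> j))) * (signof p' * (\<Prod>j<m. h (p' j) (\<phi> j))))
      = (if p = p' then (\<Prod>i<m. \<Sum>x\<in>X. (h i x)\<^sup>2) else 0)"
    if p: "p \<in> ?P" and p': "p' \<in> ?P" for p p'
  proof -
    have "(\<Sum>\<phi>\<in>?F. (signof p * (\<Prod>j<m. h (p j) (\<phi> j))) * (signof p' * (\<Prod>j<m. h (p' j) (\<phi> j)))) =
      signof p * signof p' * (\<Sum>\<phi>\<in>?F. \<Prod>j<m. h (p j) (\<phi> j) * h (p' j) (\<phi> j))"
      by (simp add: prod.distrib sum_distrib_left mult_ac)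
    also have "(\<Sum>\<phi>\<in>?F. \<Prod>j<m. h (p j) (\<phi> j) * h (p' j) (\<phi> j)) =
      (\<Prod>j<m. \<Sum>x\<in>X. h (p j) x * h (p' j) x)"
      using X by (subst prod_sum_PiE) auto
    also have "signof p * signof p' * \<dots> = (if p = p' then (\<Prod>i<m. \<Sum>x\<in>X. (h i x)\<^sup>2) else 0)"
    proof (cases "p = p'")
      case True
      have "(\<Prod>j<m. \<Sum>x\<in>X. (h (p j) x)\<^sup>2) = (\<Prod>i<m. \<Sum>x\<in>X. (h i x)\<^sup>2)"
        using p by (intro prod.permute[symmetric, unfolded comp_def]) (simp add: atLeast0LessThan)
      then show ?thesis using True by (simp add: power2_eq_square sign_def)
    next
      case False
      then obtain j where "p j \<noteq> p' j" by auto
      then have j: "j < m" using p p' by (metis mem_Collect_eq permutes_not_in atLeastLessThan_iff le0)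
      have "(\<Prod>j<m. \<Sum>x\<in>X. h (p j) x * h (p' j) x) = 0"
        using j orth[OF pm[OF p j] pm[OF p' j] \<open>p j \<noteq> p' j\<close>] by (intro prod_zero) auto
      then show ?thesis using False by simp
    qed
    finally show ?thesis .
  qed
  have "(\<Sum>\<phi>\<in>?F. (det (mat m m (\<lambda>(i, j). h i (\<phi> j))))\<^sup>2) =
    (\<Sum>p\<in>?P. \<Sum>p'\<in>?P. \<Sum>\<phi>\<in>?F. (signof p * (\<Prod>j<m. h (p j) (\<phi> j))) * (signof p' * (\<Prod>j<m. h (p' j) (\<phi> j))))"
    by (simp add: det power2_eq_square sum_product sum.swap[of _ ?F])
  also have "\<dots> = (\<Sum>p\<in>?P. \<Sum>p'\<in>?P. if p = p' then (\<Prod>i<m. \<Sum>x\<in>X. (h i x)\<^sup>2) else 0)"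
    by (intro sum.cong refl pair)
  also have "\<dots> = (\<Sum>p\<in>?P. \<Prod>i<m. \<Sum>x\<in>X. (h i x)\<^sup>2)"
    using fP by (intro sum.cong) auto
  also have "\<dots> = fact m * (\<Prod>i<m. \<Sum>x\<in>X. (h i x)\<^sup>2)"
    by (simp add: card_permutations[of _ m])
  finally show ?thesis .
qed

text \<open>Passing to the orthogonalised rows keeps every determinant and does not increase any row
  norm, which is Hadamard's argument.\<close>

lemma sum_det_square_le:
  fixes r :: "nat \<Rightarrow> 'x \<Rightarrow> real"
  assumes X: "finite X"
  shows "(\<Sum>\<phi>\<in>{..<m} \<rightarrow>\<^sub>E X. (det (mat m m (\<lambda>(i, j). r i (\<phi> j))))\<^sup>2) \<le>
    fact m * (\<Prod>i<m. \<Sum>x\<in>X. (r i x)\<^sup>2)"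
proof -
  have "(\<Sum>\<phi>\<in>{..<m} \<rightarrow>\<^sub>E X. (det (mat m m (\<lambda>(i, j). r i (\<phi> j))))\<^sup>2) =
    fact m * (\<Prod>i<m. \<Sum>x\<in>X. (orthogonalized X r i x)\<^sup>2)"
    unfolding orthogonalized_det[OF X, where r = r]
    by (rule sum_det_square_orthogonal[OF X]) (rule orthogonalized_orthogonal[OF X])
  also have "\<dots> \<le> fact m * (\<Prod>i<m. \<Sum>x\<in>X. (r i x)\<^sup>2)"
    by (intro mult_left_mono prod_mono conjI orthogonalized_norm_le X sum_nonneg) auto
  finally show ?thesis .
qed

lemma card_bij_extensional:
  assumes F: "finite F" "card F = m"
  shows "card {\<phi> \<in> {..<m} \<rightarrow>\<^sub>E F. bij_betw \<phi> {..<m} F} = fact m"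
proof -
  have "{\<phi> \<in> {..<m} \<rightarrow>\<^sub>E F. bij_betw \<phi> {..<m} F} = {\<phi> \<in> {..<m} \<rightarrow>\<^sub>E F. inj_on \<phi> {..<m}}"
  proof (intro Collect_cong conj_cong refl iffI)
    fix \<phi> assume \<phi>: "\<phi> \<in> {..<m} \<rightarrow>\<^sub>E F" and inj: "inj_on \<phi> {..<m}"
    have "\<phi> ` {..<m} = F"
      using \<phi> F card_image[OF inj] by (intro card_subset_eq) (auto simp: PiE_iff)
    then show "bij_betw \<phi> {..<m} F" using inj by (simp add: bij_betw_def)
  qed (simp add: bij_betw_def)
  also have "card \<dots> = fact m"
    using card_inj_on_subset_funcset[of "{..<m}" F "{..<m}"] F by (simp add: fact_prod_rev)
  finally show ?thesis .
qed

text \<open>Cauchy--Binet and Hadamard's inequality in one statement: \<open>w S\<close> is a lower bound for the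
  squared maximal minor with column set \<open>F S\<close>.\<close>

lemma sum_minors_le:
  fixes r :: "nat \<Rightarrow> 'x \<Rightarrow> real" and w :: "'s \<Rightarrow> real" and F :: "'s \<Rightarrow> 'x set"
  assumes X: "finite X" and inj: "inj_on F I"
    and FX: "\<And>S. S \<in> I \<Longrightarrow> F S \<subseteq> X" and cF: "\<And>S. S \<in> I \<Longrightarrow> card (F S) = m"
    and w: "\<And>S \<phi>. S \<in> I \<Longrightarrow> bij_betw \<phi> {..<m} (F S) \<Longrightarrow>
      w S \<le> (det (mat m m (\<lambda>(i, j). r i (\<phi> j))))\<^sup>2"
  shows "(\<Sum>S\<in>I. w S) \<le> (\<Prod>i<m. \<Sum>x\<in>X. (r i x)\<^sup>2)"
proof -
  let ?D = "\<lambda>\<phi>. (det (mat m m (\<lambda>(i, j). r i (\<phi> j))))\<^sup>2"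
  define B where "B S = {\<phi> \<in> {..<m} \<rightarrow>\<^sub>E F S. bij_betw \<phi> {..<m} (F S)}" for S
  have fI: "finite I"
    by (rule inj_on_finite[OF inj, of "Pow X"]) (use FX X in auto)
  have fF: "finite (F S)" if "S \<in> I" for S
    using FX[OF that] X by (rule finite_subset)
  have fB: "finite (B S)" if "S \<in> I" for S
    unfolding B_def
    by (rule finite_subset[of _ "{..<m} \<rightarrow>\<^sub>E F S"]) (use fF[OF that] in \<open>auto intro!: finite_PiE\<close>)
  \<comment> \<open>Each \<open>S\<close> is repeated once per enumeration of \<open>F S\<close>, to
    match the sum over functions in \<open>sum_det_square_le\<close>; the factor
    \<open>fact m\<close> cancels at the end.\<close>
  have "fact m * (\<Sum>S\<in>I. w S) = (\<Sum>S\<in>I. \<Sum>\<phi>\<in>B S. w S)"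
    using cF fF by (simp add: B_def card_bij_extensional sum_distrib_left)
  also have "\<dots> \<le> (\<Sum>S\<in>I. \<Sum>\<phi>\<in>B S. ?D \<phi>)"
    by (intro sum_mono w) (auto simp: B_def)
  also have "\<dots> = (\<Sum>\<phi>\<in>(\<Union>S\<in>I. B S). ?D \<phi>)"
  proof (rule sum.UNION_disjoint[symmetric, OF fI])
    show "\<forall>S\<in>I. \<forall>S'\<in>I. S \<noteq> S' \<longrightarrow> B S \<inter> B S' = {}"
      using inj by (auto simp: B_def bij_betw_def inj_on_def)
  qed (simp add: fB)
  also have "\<dots> \<le> (\<Sum>\<phi>\<in>{..<m} \<rightarrow>\<^sub>E X. ?D \<phi>)"
  proof (rule sum_mono2)
    show "(\<Union>S\<in>I. B S) \<subseteq> {..<m} \<rightarrow>\<^sub>E X"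
      using FX PiE_mono[of "{..<m}" "\<lambda>_. F _" "\<lambda>_. X"] unfolding B_def by blast
  qed (use X in \<open>auto intro: finite_PiE\<close>)
  also have "\<dots> \<le> fact m * (\<Prod>i<m. \<Sum>x\<in>X. (r i x)\<^sup>2)"
    by (rule sum_det_square_le[OF X])
  finally show ?thesis
    by (simp add: mult_le_cancel_left)
qed

section \<open>Index of a lattice\<close>

text \<open>Membership in the lattice spanned by the columns of \<open>A\<close>. Vectors are
  functions on all naturals that are compared on indices below \<open>m\<close> only.\<close>

definition in_lattice :: "nat \<Rightarrow> (nat \<Rightarrow> nat \<Rightarrow> int) \<Rightarrow> (nat \<Rightarrow> int) \<Rightarrow> bool" where
  "in_lattice m A x \<longleftrightarrow> (\<exists>y. \<forall>i<m. x i = (\<Sum>j<m. A i j * y j))"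

lemma in_lattice_lincomb:
  assumes "in_lattice m A x" "in_lattice m A y"
  shows "in_lattice m A (\<lambda>i. x i - q * y i)"
proof -
  obtain u v where "\<forall>i<m. x i = (\<Sum>j<m. A i j * u j)" "\<forall>i<m. y i = (\<Sum>j<m. A i j * v j)"
    using assms unfolding in_lattice_def by blast
  then have "\<forall>i<m. x i - q * y i = (\<Sum>j<m. A i j * (u j - q * v j))"
    by (simp add: algebra_simps sum_subtractf sum_distrib_left)
  then show ?thesis unfolding in_lattice_def by (rule exI[of _ "\<lambda>j. u j - q * v j"])
qed

lemma in_lattice_column: "j < m \<Longrightarrow> in_lattice m A (\<lambda>i. A i j)"
  unfolding in_lattice_def by (rule exI[of _ "\<lambda>l. if l = j then 1 else 0"]) (simp add: if_distrib cong: if_cong)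

lemma det_mat_mult:
  fixes A B C :: "nat \<Rightarrow> nat \<Rightarrow> int"
  assumes "\<And>i j. i < m \<Longrightarrow> j < m \<Longrightarrow> A i j = (\<Sum>l<m. B i l * C l j)"
  shows "det (mat m m (\<lambda>(i, j). A i j)) = det (mat m m (\<lambda>(i, j). B i j)) * det (mat m m (\<lambda>(i, j). C i j))"
proof -
  have "mat m m (\<lambda>(i, j). A i j) = mat m m (\<lambda>(i, j). B i j) * mat m m (\<lambda>(i, j). C i j)"
    by (rule eq_matI) (simp_all add: assms scalar_prod_def atLeast0LessThan)
  then show ?thesis by (simp add: det_mult[of _ m])
qed

lemma det_mat_lower_triangular:
  fixes B :: "nat \<Rightarrow> nat \<Rightarrow> int"
  assumes "\<And>i j. i < j \<Longrightarrow> j < m \<Longrightarrow> B i j = 0"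
  shows "det (mat m m (\<lambda>(i, j). B i j)) = (\<Prod>i<m. B i i)"
  using assms by (subst det_lower_triangular[of m]) (auto simp: prod_list_diag_prod atLeast0LessThan)

text \<open>A triangular basis \<open>b\<close> of the lattice has index at most the product of its diagonal
  entries \<open>g\<close>, and this product divides the determinant.\<close>

lemma lattice_index_le_det:
  fixes A :: "nat \<Rightarrow> nat \<Rightarrow> int"
  assumes tors: "\<And>i. i < m \<Longrightarrow> \<exists>k\<noteq>0. in_lattice m A (\<lambda>j. if j = i then k else 0)"
  obtains R :: "(nat \<Rightarrow> int) set" where "finite R" "int (card R) \<le> \<bar>det (mat m m (\<lambda>(i, j). A i j))\<bar>"
    "\<And>x. \<exists>r\<in>R. in_lattice m A (\<lambda>i. x i - r i)"
proof -
  let ?L = "in_lattice m A"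
  \<comment> \<open>The entries at \<open>i\<close> of vectors in \<open>Z i\<close> form an ideal
    of the integers, nonzero by \<open>tors\<close>. A vector whose entry there is the least
    positive one supplies a generator, and it becomes the basis vector \<open>b i\<close>.\<close>
  define Z where "Z i x \<longleftrightarrow> ?L x \<and> (\<forall>j<i. x j = 0)" for i x
  have "\<exists>x. Z i x \<and> x i > 0 \<and> (\<forall>z. Z i z \<longrightarrow> x i dvd z i)" if i: "i < m" for i
  proof -
    obtain k where k: "k \<noteq> 0" "?L (\<lambda>j. if j = i then k else 0)" using tors[OF i] by blast
    then have "Z i (\<lambda>j. if j = i then k else 0)" by (simp add: Z_def)
    moreover have Z_lin: "Z i (\<lambda>j. x j - q * y j)" if "Z i x" "Z i y" for x y q
      using that in_lattice_lincomb by (auto simp: Z_def)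
    ultimately have "\<exists>x. Z i x \<and> x i > 0"
    proof (cases "k > 0")
      case False
      \<comment> \<open>Negation in the form \<open>x - 2 * x\<close>, since \<open>Z_lin\<close>
        provides only such combinations.\<close>
      have "Z i (\<lambda>j. (if j = i then k else 0) - 2 * (if j = i then k else 0))"
        by (rule Z_lin) fact+
      then show ?thesis using False k by (intro exI conjI) auto
    qed auto
    then obtain x0 where "Z i x0 \<and> x0 i > 0" by (elim exE)
    from ex_has_least_nat[of "\<lambda>x. Z i x \<and> x i > 0", OF this, of "\<lambda>x. nat (x i)"]
    obtain x where x: "Z i x" "x i > 0" and min: "\<And>y. Z i y \<Longrightarrow> y i > 0 \<Longrightarrow> nat (x i) \<le> nat (y i)"
      by auto
    have "x i dvd z i" if z: "Z i z" for z
    proof (rule ccontr)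
      assume nd: "\<not> x i dvd z i"
      let ?y = "\<lambda>j. z j - (z i div x i) * x j"
      have y: "?y i = z i mod x i" by (simp add: minus_div_mult_eq_mod)
      have "?y i > 0" unfolding y using nd x(2) by (simp add: dvd_eq_mod_eq_0 pos_mod_sign order_le_neq_trans)
      moreover have "?y i < x i" unfolding y using x(2) by simp
      ultimately show False using min[OF Z_lin[OF z x(1), of "z i div x i"]] by simp
    qed
    then show ?thesis using x by (intro exI[of _ x]) simp
  qed
  then obtain b where b: "\<And>i. i < m \<Longrightarrow> Z i (b i)" and pos: "\<And>i. i < m \<Longrightarrow> b i i > 0"
    and dvd: "\<And>i z. i < m \<Longrightarrow> Z i z \<Longrightarrow> b i i dvd z i"
    by metis
  define g where "g i = b i i" for i
  have bL: "?L (b i)" and b0: "j < i \<Longrightarrow> b i j = 0" if "i < m" for i j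
    using b[OF that] by (auto simp: Z_def)
  \<comment> \<open>Elimination from the top: subtracting a multiple of \<open>b i\<close> clears
    entry \<open>i\<close> and moves the vector from \<open>Z i\<close> to \<open>Z (Suc i)\<close>,
    hence the induction on \<open>m - i\<close>.\<close>
  have span: "\<exists>c. \<forall>i<m. x i = (\<Sum>l<m. b l i * c l)" if "i \<le> m" "Z i x" for i x
    using that
  proof (induction "m - i" arbitrary: i x)
    case 0
    then show ?case by (intro exI[of _ "\<lambda>_. 0"]) (auto simp: Z_def)
  next
    case (Suc d)
    then have i: "i < m" by simp
    define q where "q = x i div b i i"
    have q: "x i = q * b i i" using dvd[OF i Suc.prems(2)] by (simp add: q_def)
    have d: "d = m - Suc i" and Si: "Suc i \<le> m" using Suc.hyps(2) i by auto
    have "Z (Suc i) (\<lambda>j. x j - q * b i j)"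
      using Suc.prems(2) q b0[OF i] in_lattice_lincomb[OF _ bL[OF i]] by (auto simp: Z_def less_Suc_eq)
    from Suc.hyps(1)[OF d Si this]
    obtain c where c: "\<forall>j<m. x j - q * b i j = (\<Sum>l<m. b l j * c l)" by blast
    have "x j = (\<Sum>l<m. b l j * (c l + (if l = i then q else 0)))" if "j < m" for j
    proof -
      have "(\<Sum>l<m. b l j * (c l + (if l = i then q else 0))) = (\<Sum>l<m. b l j * c l) + b i j * q"
      proof -
        have "b l j * (c l + (if l = i then q else 0)) = b l j * c l + (if l = i then b i j * q else 0)" for l
          by (simp add: distrib_left)
        then show ?thesis using i by (simp add: sum.distrib)
      qed
      then show ?thesis using c that by (simp add: mult.commute algebra_simps)
    qed
    then show ?case by (intro exI[of _ "\<lambda>l. c l + (if l = i then q else 0)"]) simp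
  qed
  \<comment> \<open>Entries are reduced in increasing order; a multiple of \<open>b i\<close> leaves
    the earlier ones intact because \<open>b i\<close> vanishes there.\<close>
  have reduce: "\<exists>y. ?L (\<lambda>j. x j - y j) \<and> (\<forall>j<i. 0 \<le> y j \<and> y j < g j)" if "i \<le> m" for i x
    using that
  proof (induction i)
    case 0
    have "?L (\<lambda>j. x j - x j)" unfolding in_lattice_def by (rule exI[of _ "\<lambda>_. 0"]) simp
    then show ?case by (intro exI[of _ x]) simp
  next
    case (Suc i)
    then obtain y where y: "?L (\<lambda>j. x j - y j)" "\<forall>j<i. 0 \<le> y j \<and> y j < g j" by auto
    have i: "i < m" using Suc by simp
    define q where "q = y i div g i"
    have "?L (\<lambda>j. (x j - y j) - (- q) * b i j)"
      by (rule in_lattice_lincomb[OF y(1) bL[OF i]])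
    then have "?L (\<lambda>j. x j - (y j - q * b i j))" by (simp add: algebra_simps)
    moreover have "y i - q * b i i = y i mod g i"
      by (simp add: q_def g_def minus_div_mult_eq_mod)
    then have "0 \<le> y i - q * b i i \<and> y i - q * b i i < g i"
      using pos[OF i] by (simp only: g_def) simp
    then have "\<forall>j<Suc i. 0 \<le> y j - q * b i j \<and> y j - q * b i j < g j"
      using y(2) b0[OF i] by (simp add: less_Suc_eq)
    ultimately show ?case by (intro exI[of _ "\<lambda>j. y j - q * b i j"] conjI)
  qed
  define R where "R = PiE {..<m} (\<lambda>i. {0..<g i})"
  have "\<exists>r\<in>R. ?L (\<lambda>i. x i - r i)" for x
  proof -
    obtain y where y: "?L (\<lambda>j. x j - y j)" "\<forall>j<m. 0 \<le> y j \<and> y j < g j" using reduce[of m x, OF order_refl] by (elim exE conjE)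
    have "restrict y {..<m} \<in> R" using y(2) by (auto simp: R_def)
    moreover have "?L (\<lambda>i. x i - restrict y {..<m} i)"
      using y(1) by (simp add: in_lattice_def)
    ultimately show ?thesis by (intro bexI[of _ "restrict y {..<m}"])
  qed
  moreover have "finite R" by (simp add: R_def finite_PiE)
  moreover have "int (card R) \<le> \<bar>det (mat m m (\<lambda>(i, j). A i j))\<bar>"
  proof -
    have "int (card R) = (\<Prod>i<m. g i)"
      using pos by (simp add: R_def card_PiE g_def less_imp_le)
    also have "\<dots> = det (mat m m (\<lambda>(i, j). b j i))"
      using b0 by (subst det_mat_lower_triangular) (auto simp: g_def)
    finally have R: "int (card R) = det (mat m m (\<lambda>(i, j). b j i))" .
    \<comment> \<open>Writing the columns of \<open>A\<close> in the basis \<open>b\<close> factors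
      \<open>A\<close> through the triangular matrix, so \<open>card R\<close> divides the
      determinant of \<open>A\<close>.\<close>
    have "\<exists>c. \<forall>i<m. A i j = (\<Sum>l<m. b l i * c l)" if "j < m" for j
      using span[of 0 "\<lambda>i. A i j"] in_lattice_column[OF that] by (simp add: Z_def)
    then obtain c where c: "\<And>i j. i < m \<Longrightarrow> j < m \<Longrightarrow> A i j = (\<Sum>l<m. b l i * c j l)" by metis
    have detA: "det (mat m m (\<lambda>(i, j). A i j)) = int (card R) * det (mat m m (\<lambda>(l, j). c j l))"
      unfolding R by (rule det_mat_mult[where B = "\<lambda>i l. b l i" and C = "\<lambda>l j. c j l"]) (rule c)
    \<comment> \<open>Divisibility gives a bound only for a nonzero determinant. By
      \<open>tors\<close>, some product of \<open>A\<close> with an integer matrix is diagonal with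
      nonzero entries, so the determinant of \<open>A\<close> cannot be 0.\<close>
    obtain k where k: "\<And>i. i < m \<Longrightarrow> k i \<noteq> 0"
      and kL: "\<And>i. i < m \<Longrightarrow> ?L (\<lambda>j. if j = i then k i else 0)"
      using tors by metis
    then obtain d where d: "\<And>i j. i < m \<Longrightarrow> j < m \<Longrightarrow> (if j = i then k i else 0) = (\<Sum>l<m. A j l * d i l)"
      unfolding in_lattice_def by metis
    have "det (mat m m (\<lambda>(j, i). if j = i then k i else 0)) =
        det (mat m m (\<lambda>(i, j). A i j)) * det (mat m m (\<lambda>(l, i). d i l))"
      by (rule det_mat_mult[where A = "\<lambda>j i. if j = i then k i else 0" and C = "\<lambda>l i. d i l"]) (rule d)
    moreover have "det (mat m m (\<lambda>(j, i). if j = i then k i else 0)) = (\<Prod>i<m. k i)"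
      by (subst det_mat_lower_triangular) auto
    moreover have "(\<Prod>i<m. k i) \<noteq> 0" using k by simp
    ultimately have "det (mat m m (\<lambda>(i, j). A i j)) \<noteq> 0" by auto
    then have "det (mat m m (\<lambda>(l, j). c j l)) \<noteq> 0" unfolding detA by simp
    then have "1 \<le> \<bar>det (mat m m (\<lambda>(l, j). c j l))\<bar>" by linarith
    then show ?thesis
      unfolding detA by (simp add: abs_mult mult_le_cancel_left1)
  qed
  ultimately show thesis by (intro that)
qed

section \<open>Homology modulo two\<close>

lemma card_UNIV_bit: "card (UNIV :: bit set) = 2"
proof -
  have "(UNIV :: bit set) = {0, 1}" using bit_not_one_iff by auto
  then show ?thesis unfolding card_2_iff by (intro exI[of _ 0] exI[of _ 1]) simp
qed

lemma finite_UNIV_bit: "finite (UNIV :: bit set)"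
  by (rule card_ge_0_finite) (simp add: card_UNIV_bit)

text \<open>A finite carrier spans itself, so there is a finite basis, and coordinates identify
  vectors with functions from the basis to the field.\<close>

lemma (in vectorspace) card_carrier_eq_power_dim:
  assumes finV: "finite (carrier V)"
  shows "card (carrier V) = card (carrier K) ^ dim"
proof -
  have "span (carrier V) = carrier V"
    using in_own_span[of "carrier V"] span_is_subset2[of "carrier V"] by auto
  then have fd: "fin_dim" unfolding fin_dim_def using finV by (intro exI[of _ "carrier V"]) simp
  then obtain A where A: "finite A" "basis A" using finite_basis_exists by auto
  then have AC: "A \<subseteq> carrier V" by (simp add: basis_def)
  have uniq: "\<exists>!a. a \<in> A \<rightarrow>\<^sub>E carrier K \<and> lincomb a A = v" if "v \<in> carrier V" for v
    by (rule basis_criterion[OF A(1) AC, THEN iffD1, OF A(2), rule_format, OF that])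
  have lc: "lincomb a A \<in> carrier V" if "a \<in> A \<rightarrow>\<^sub>E carrier K" for a
    using that AC by (intro lincomb_closed) auto
  have "bij_betw (\<lambda>a. lincomb a A) (A \<rightarrow>\<^sub>E carrier K) (carrier V)"
    unfolding bij_betw_def
  proof
    show "inj_on (\<lambda>a. lincomb a A) (A \<rightarrow>\<^sub>E carrier K)"
      using uniq lc unfolding inj_on_def by metis
    show "(\<lambda>a. lincomb a A) ` (A \<rightarrow>\<^sub>E carrier K) = carrier V"
      using uniq lc by (auto simp: image_iff) metis
  qed
  then have "card (carrier V) = card (A \<rightarrow>\<^sub>E carrier K)"
    by (simp add: bij_betw_same_card)
  also have "\<dots> = card (carrier K) ^ dim"
    using A by (simp add: card_PiE dim_basis)
  finally show ?thesis .
qed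

section \<open>Boundaries, cycles and the order of the homology group\<close>

lemma k_boundaries_zero: "(\<lambda>_. 0) \<in> k_boundaries K k"
  unfolding k_boundaries_def
  by (rule image_eqI[of _ _ "\<lambda>_. 0"]) (auto simp: k_chains_def boundary_def fun_eq_iff)

lemma k_boundaries_add:
  assumes "x \<in> k_boundaries K k" "y \<in> k_boundaries K k"
  shows "(\<lambda>\<sigma>. x \<sigma> + y \<sigma>) \<in> k_boundaries K k"
proof -
  obtain c d where "c \<in> k_chains K (Suc k)" "d \<in> k_chains K (Suc k)" "x = boundary K c" "y = boundary K d"
    using assms by (auto simp: k_boundaries_def)
  then show ?thesis
    unfolding k_boundaries_def
    by (intro image_eqI[of _ _ "\<lambda>\<sigma>. c \<sigma> + d \<sigma>"]) (auto simp: k_chains_def boundary_add)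
qed

lemma k_boundaries_scale:
  assumes "x \<in> k_boundaries K k"
  shows "(\<lambda>\<sigma>. a * x \<sigma>) \<in> k_boundaries K k"
proof -
  obtain c where "c \<in> k_chains K (Suc k)" "x = boundary K c"
    using assms by (auto simp: k_boundaries_def)
  then show ?thesis
    unfolding k_boundaries_def
    by (intro image_eqI[of _ _ "\<lambda>\<sigma>. a * c \<sigma>"]) (auto simp: k_chains_def boundary_scale)
qed

lemma k_boundaries_subset_cycles: "abstract_complex K \<Longrightarrow> k_boundaries K k \<subseteq> k_cycles K k"
  by (auto simp: k_boundaries_def k_cycles_def boundary_boundary boundary_in_chains)

lemma subgroup_k_boundaries:
  assumes K: "abstract_complex K"
  shows "subgroup (k_boundaries K k :: (nat set \<Rightarrow> 'r::comm_ring_1) set) (add_monoid (cycle_module K k))"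
proof -
  interpret module "class_ring :: 'r ring" "cycle_module K k" by (rule module_cycle_module)
  have inv: "\<ominus>\<^bsub>cycle_module K k\<^esub> x = (\<lambda>\<sigma>. - 1 * x \<sigma>)" if "x \<in> k_cycles K k" for x :: "nat set \<Rightarrow> 'r"
  proof (rule minus_equality)
    show "(\<lambda>\<sigma>. - 1 * x \<sigma>) \<in> carrier (cycle_module K k)"
      using that by (simp add: cycle_module_def k_cycles_def k_chains_def boundary_scale[of K "-1" x, simplified])
  qed (use that in \<open>auto simp: cycle_module_def\<close>)
  have sub: "k_boundaries K k \<subseteq> (k_cycles K k :: (nat set \<Rightarrow> 'r) set)"
    by (rule k_boundaries_subset_cycles[OF K])
  show ?thesis
  proof (rule group.subgroupI[OF a_group])
    show "(k_boundaries K k :: (nat set \<Rightarrow> 'r) set) \<subseteq> carrier (add_monoid (cycle_module K k))"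
      using sub by (simp add: cycle_module_def)
    show "(k_boundaries K k :: (nat set \<Rightarrow> 'r) set) \<noteq> {}" using k_boundaries_zero by blast
    fix x y :: "nat set \<Rightarrow> 'r" assume x: "x \<in> k_boundaries K k"
    have "inv\<^bsub>add_monoid (cycle_module K k)\<^esub> x = (\<lambda>\<sigma>. - 1 * x \<sigma>)"
      using inv[OF subsetD[OF sub x]] by (simp only: a_inv_def)
    then show "inv\<^bsub>add_monoid (cycle_module K k)\<^esub> x \<in> k_boundaries K k"
      using k_boundaries_scale[OF x, of "-1"] by simp
    assume "y \<in> k_boundaries K k"
    then show "x \<otimes>\<^bsub>add_monoid (cycle_module K k)\<^esub> y \<in> k_boundaries K k"
      using k_boundaries_add[OF x] by (simp add: cycle_module_def)
  qed
qed

lemma homology_carrier: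
  "carrier (homology K k) = rcosets\<^bsub>add_monoid (cycle_module K k)\<^esub> (k_boundaries K k)"
  by (simp add: homology_def quotient_module_def A_RCOSETS_def)

text \<open>Lagrange's theorem. The product form remains valid for infinite groups, where
  \<open>card\<close> is 0.\<close>

lemma card_homology:
  assumes "abstract_complex K"
  shows "card (carrier (homology K k :: ('r::comm_ring_1, _) module)) *
    card (k_boundaries K k :: (nat set \<Rightarrow> 'r) set) = card (k_cycles K k :: (nat set \<Rightarrow> 'r) set)"
proof -
  interpret module "class_ring :: 'r ring" "cycle_module K k" by (rule module_cycle_module)
  show ?thesis
    using group.lagrange[OF a_group subgroup_k_boundaries[OF assms]]
    by (simp add: homology_carrier order_def) (simp add: cycle_module_def)
qed

text \<open>If \<open>e\<close> is a facet of \<open>\<tau>\<close>, then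
  \<open>the_elem (\<tau> - e)\<close> is the vertex opposite to \<open>e\<close>, and the sign is
  the one used in \<open>boundary\<close>. For any other \<open>e \<subseteq> \<tau>\<close> the
  value is still a sign, so \<open>incidence_square\<close> holds without assumptions on
  cardinalities.\<close>

definition incidence :: "nat set \<Rightarrow> nat set \<Rightarrow> 'r::comm_ring_1" where
  "incidence e \<tau> = (if e \<subseteq> \<tau> then (- 1) ^ card {u \<in> e. u < the_elem (\<tau> - e)} else 0)"

text \<open>Matching \<open>v\<close> with the face \<open>insert v e\<close> turns the boundary
  into a matrix product whose entries do not depend on the complex.\<close>

lemma boundary_incidence:
  assumes K: "abstract_complex K" and e: "e \<in> faces K k"
  shows "boundary K c e = (\<Sum>\<tau>\<in>faces K (Suc k). incidence e \<tau> * c \<tau>)"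
proof -
  have fe: "finite e" and ce: "card e = Suc k" and eK: "e \<in> K"
    using K e by (auto simp: faces_def abstract_complex_def)
  have fK: "finite K" using K by (simp add: abstract_complex_def)
  have "(\<Sum>\<tau>\<in>faces K (Suc k). incidence e \<tau> * c \<tau>) = (\<Sum>\<tau>\<in>{\<tau> \<in> faces K (Suc k). e \<subseteq> \<tau>}. incidence e \<tau> * c \<tau>)"
    using fK by (intro sum.mono_neutral_right) (auto simp: faces_def incidence_def)
  also have "\<dots> = (\<Sum>v \<in> {v. v \<notin> e \<and> insert v e \<in> K}. (- 1) ^ card {u \<in> e. u < v} * c (insert v e))"
  proof (rule sum.reindex_bij_witness[where i = "\<lambda>v. insert v e" and j = "\<lambda>\<tau>. the_elem (\<tau> - e)"])
    fix \<tau> assume "\<tau> \<in> {\<tau> \<in> faces K (Suc k). e \<subseteq> \<tau>}"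
    then have \<tau>: "\<tau> \<in> K" "card \<tau> = Suc (Suc k)" "e \<subseteq> \<tau>" by (auto simp: faces_def)
    then have "card (\<tau> - e) = 1" using fe ce by (simp add: card_Diff_subset)
    then obtain v where v: "\<tau> - e = {v}" by (auto simp: card_1_singleton_iff)
    then have \<tau>v: "\<tau> = insert v e" "v \<notin> e" using \<tau> by auto
    show "insert (the_elem (\<tau> - e)) e = \<tau>" using v \<tau>v by simp
    show "the_elem (\<tau> - e) \<in> {v. v \<notin> e \<and> insert v e \<in> K}" using v \<tau>v \<tau> by simp
    show "(- 1) ^ card {u \<in> e. u < the_elem (\<tau> - e)} * c (insert (the_elem (\<tau> - e)) e) = incidence e \<tau> * c \<tau>"
      using v \<tau>v by (simp add: incidence_def subset_insertI)
  next
    fix v assume v: "v \<in> {v. v \<notin> e \<and> insert v e \<in> K}"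
    have d: "insert v e - e = {v}" using v by auto
    show "the_elem (insert v e - e) = v" by (simp add: d)
    show "insert v e \<in> {\<tau> \<in> faces K (Suc k). e \<subseteq> \<tau>}" using v fe ce by (auto simp: faces_def)
  qed
  finally show ?thesis using eK by (simp add: boundary_def)
qed

lemma incidence_square: "(incidence e \<tau>)\<^sup>2 = (if e \<subseteq> \<tau> then 1 else 0)"
  by (simp add: incidence_def flip: power_mult)

lemma incidence_bit: "(incidence e \<tau> :: bit) = (if e \<subseteq> \<tau> then 1 else 0)"
proof -
  have "(- 1 :: bit) = 1" by (cases "- 1 :: bit") auto
  then show ?thesis by (simp add: incidence_def)
qed

text \<open>The coboundary of the cochain \<open>s\<close>, in multiplicative form.\<close>

definition triangle_sign :: "('v set \<Rightarrow> real) \<Rightarrow> 'v set \<Rightarrow> real" where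
  "triangle_sign s \<tau> = (\<Prod>e\<in>edges_on \<tau>. s e)"

lemma finite_k_chains_bit:
  assumes "finite K"
  shows "finite (k_chains K k :: (nat set \<Rightarrow> bit) set)"
    and "card (k_chains K k :: (nat set \<Rightarrow> bit) set) \<le> 2 ^ card (faces K k)"
proof -
  have fE: "finite (faces K k)" using assms by (simp add: faces_def)
  let ?P = "faces K k \<rightarrow>\<^sub>E (UNIV :: bit set)"
  have fP: "finite ?P" using fE finite_UNIV_bit by (auto intro: finite_PiE)
  have inj: "inj_on (\<lambda>c. restrict c (faces K k)) (k_chains K k :: (nat set \<Rightarrow> bit) set)"
  proof (rule inj_onI, rule ext)
    fix c d :: "nat set \<Rightarrow> bit" and \<sigma>
    assume *: "c \<in> k_chains K k" "d \<in> k_chains K k" "restrict c (faces K k) = restrict d (faces K k)"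
    show "c \<sigma> = d \<sigma>"
      using *(1,2) fun_cong[OF *(3), of \<sigma>] by (cases "\<sigma> \<in> faces K k") (auto simp: k_chains_def)
  qed
  have img: "(\<lambda>c. restrict c (faces K k)) ` (k_chains K k :: (nat set \<Rightarrow> bit) set) \<subseteq> ?P" by auto
  show "finite (k_chains K k :: (nat set \<Rightarrow> bit) set)"
    using inj_on_finite[OF inj img fP] .
  show "card (k_chains K k :: (nat set \<Rightarrow> bit) set) \<le> 2 ^ card (faces K k)"
    using card_inj_on_le[OF inj img fP] fE by (simp add: card_PiE card_UNIV_bit)
qed

text \<open>The pairing of a cochain \<open>s\<close> with a chain \<open>x\<close> modulo 2, with
  values in the signs.\<close>

definition character :: "'e set \<Rightarrow> ('e \<Rightarrow> real) \<Rightarrow> ('e \<Rightarrow> bit) \<Rightarrow> real" where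
  "character E s x = (\<Prod>e\<in>E. if x e = 1 then s e else 1)"

lemma character_add:
  assumes "s \<in> sign_functions E"
  shows "character E s (\<lambda>e. x e + y e) = character E s x * character E s y"
  unfolding character_def prod.distrib[symmetric]
proof (rule prod.cong[OF refl])
  fix e assume "e \<in> E"
  then have "s e * s e = 1" using assms by (auto simp: sign_functions_def PiE_iff)
  then show "(if x e + y e = 1 then s e else 1) = (if x e = 1 then s e else 1) * (if y e = 1 then s e else 1)"
    by (cases "x e"; cases "y e") auto
qed

text \<open>The sum of \<open>character E s b\<close> over all \<open>s\<close> and all \<open>b \<in> B\<close> is evaluated in both orders; in
  each order the inner sums vanish by orthogonality except for the trivial ones.\<close>

lemma card_annihilator:
  fixes B :: "('e \<Rightarrow> bit) set"
  assumes E: "finite E" and B: "finite B" and supp: "\<And>b e. b \<in> B \<Longrightarrow> e \<notin> E \<Longrightarrow> b e = 0"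
    and zero: "(\<lambda>_. 0) \<in> B" and add: "\<And>x y. x \<in> B \<Longrightarrow> y \<in> B \<Longrightarrow> (\<lambda>e. x e + y e) \<in> B"
  shows "card {s \<in> sign_functions E. \<forall>b\<in>B. character E s b = 1} * card B = 2 ^ card E"
proof -
  let ?T = "{s \<in> sign_functions E. \<forall>b\<in>B. character E s b = 1}"
  have fS: "finite (sign_functions E)" using E by (rule finite_sign_functions)
  have by_s: "(\<Sum>b\<in>B. character E s b) = (if s \<in> ?T then real (card B) else 0)"
    if s: "s \<in> sign_functions E" for s
  proof (cases "s \<in> ?T")
    case False
    then obtain b0 where b0: "b0 \<in> B" "character E s b0 \<noteq> 1" using s by blast
    have cancel: "(\<lambda>e. (x e + b0 e) + b0 e) = x" for x
    proof
      fix e show "(x e + b0 e) + b0 e = x e" by (cases "x e"; cases "b0 e") auto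
    qed
    have "(\<Sum>b\<in>B. character E s b) = (\<Sum>b\<in>B. character E s (\<lambda>e. b e + b0 e))"
      by (rule sum.reindex_bij_witness[where i = "\<lambda>b e. b e + b0 e" and j = "\<lambda>b e. b e + b0 e"])
        (auto simp only: cancel intro: add b0)
    also have "\<dots> = (\<Sum>b\<in>B. character E s b) * character E s b0"
      by (simp only: character_add[OF s] sum_distrib_right)
    finally have "(\<Sum>b\<in>B. character E s b) * (1 - character E s b0) = 0" by (simp add: algebra_simps)
    then have "(\<Sum>b\<in>B. character E s b) = 0" using b0 by simp
    then show ?thesis by (simp only: if_not_P[OF False])
  qed simp
  have by_b: "(\<Sum>s\<in>sign_functions E. character E s b) = (if b = (\<lambda>_. 0) then 2 ^ card E else 0)"
    if b: "b \<in> B" for b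
  proof (cases "b = (\<lambda>_. 0)")
    case True
    then show ?thesis by (simp add: character_def card_sign_functions[OF E])
  next
    case False
    then obtain e where "b e \<noteq> 0" by (metis ext)
    then have e: "e \<in> E" "b e = 1" using supp[OF b, of e] by auto
    have "(\<Sum>s\<in>sign_functions E. character E s b) = (\<Prod>e\<in>E. \<Sum>y\<in>{-1,1}. if b e = 1 then y else 1)"
      unfolding character_def sign_functions_def using E by (subst prod_sum_PiE) auto
    also have "\<dots> = 0" using e E by (intro prod_zero bexI[of _ e]) auto
    finally show ?thesis using False by simp
  qed
  have "real (card ?T * card B) = (\<Sum>s\<in>sign_functions E. if s \<in> ?T then real (card B) else 0)"
    using fS by (simp add: sum.If_cases Int_def)
  also have "\<dots> = (\<Sum>s\<in>sign_functions E. \<Sum>b\<in>B. character E s b)"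
    by (intro sum.cong refl by_s[symmetric])
  also have "\<dots> = (\<Sum>b\<in>B. \<Sum>s\<in>sign_functions E. character E s b)" by (rule sum.swap)
  also have "\<dots> = (\<Sum>b\<in>B. if b = (\<lambda>_. 0) then 2 ^ card E else 0)"
    by (intro sum.cong refl by_b)
  also have "\<dots> = real (2 ^ card E)" using zero B by simp
  finally show ?thesis by (simp only: of_nat_eq_iff)
qed

text \<open>Bounding the cycles by all chains, the order of the homology group is at most
  \<open>2 ^ card (faces K 1)\<close> divided by the number of boundaries, which by
  \<open>card_annihilator\<close> is the number of cochains that annihilate all boundaries. These
  are cocycles, so the right side counts cocycles without dividing out coboundaries.\<close>

lemma two_power_dim_H1_F2_le:
  assumes K: "abstract_complex K"
  shows "2 ^ dim_H1_F2 K \<le>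
    card {s \<in> sign_functions (faces K 1). \<forall>\<tau>\<in>faces K 2. triangle_sign s \<tau> = 1}"
proof -
  let ?E = "faces K 1"
  let ?B = "k_boundaries K 1 :: (nat set \<Rightarrow> bit) set"
  let ?Z = "k_cycles K 1 :: (nat set \<Rightarrow> bit) set"
  let ?T = "{s \<in> sign_functions ?E. \<forall>b\<in>?B. character ?E s b = 1}"
  let ?C = "{s \<in> sign_functions ?E. \<forall>\<tau>\<in>faces K 2. triangle_sign s \<tau> = 1}"
  have fK: "finite K" using K by (simp add: abstract_complex_def)
  have fE: "finite ?E" using fK by (simp add: faces_def)
  have ZC: "?Z \<subseteq> k_chains K 1" by (auto simp: k_cycles_def)
  have fZ: "finite ?Z" by (rule finite_subset[OF ZC finite_k_chains_bit(1)[OF fK]])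
  have BZ: "?B \<subseteq> ?Z" by (rule k_boundaries_subset_cycles[OF K])
  have fB: "finite ?B" by (rule finite_subset[OF BZ fZ])
  have cB: "card ?B > 0" using fB k_boundaries_zero by (auto simp: card_gt_0_iff)
  have cH: "card (carrier (H1_F2 K)) * card ?B = card ?Z"
    unfolding H1_F2_def by (rule card_homology[OF K])
  have "card ?Z \<le> 2 ^ card ?E"
    using card_mono[OF finite_k_chains_bit(1)[OF fK] ZC] finite_k_chains_bit(2)[OF fK, of 1] by simp
  also have "2 ^ card ?E = card ?T * card ?B"
    using BZ ZC by (intro card_annihilator[symmetric] fE fB k_boundaries_zero k_boundaries_add)
      (auto simp: k_chains_def)
  finally have "card (carrier (H1_F2 K)) * card ?B \<le> card ?T * card ?B" unfolding cH .
  then have H_T: "card (carrier (H1_F2 K)) \<le> card ?T"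
    using cB by (rule mult_right_le_imp_le)
  have TC: "?T \<subseteq> ?C"
  proof safe
    fix s \<tau> assume s: "s \<in> sign_functions ?E" and triv: "\<forall>b\<in>?B. character ?E s b = 1"
      and \<tau>: "\<tau> \<in> faces K 2"
    \<comment> \<open>Testing \<open>s\<close> on the boundary of the single triangle
      \<open>\<tau>\<close> yields exactly its triangle sign.\<close>
    define c where "c \<sigma> = (if \<sigma> = \<tau> then 1 else 0 :: bit)" for \<sigma>
    have "c \<in> k_chains K (Suc 1)" using \<tau> by (auto simp: c_def k_chains_def numeral_2_eq_2)
    then have "boundary K c \<in> ?B" by (auto simp: k_boundaries_def)
    then have \<chi>: "character ?E s (boundary K c) = 1" using triv by blast
    have "boundary K c e = (if e \<subseteq> \<tau> then 1 else 0)" if "e \<in> ?E" for e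
    proof -
      have "boundary K c e = (\<Sum>\<tau>'\<in>faces K 2. if \<tau>' = \<tau> then incidence e \<tau> else 0)"
        unfolding boundary_incidence[OF K that] numeral_2_eq_2 One_nat_def
        by (intro sum.cong) (auto simp: c_def)
      then show ?thesis using \<tau> fK by (simp add: faces_def incidence_bit)
    qed
    then have "character ?E s (boundary K c) = (\<Prod>e\<in>?E. if e \<subseteq> \<tau> then s e else 1)"
      unfolding character_def by (intro prod.cong) auto
    also have "(\<Prod>e\<in>?E. if e \<subseteq> \<tau> then s e else 1) = (\<Prod>e\<in>edges_on \<tau>. s e)"
    proof (rule prod.mono_neutral_cong_right[OF fE])
      have "e \<in> K" if "e \<subseteq> \<tau>" "card e = 2" for e
      proof -
        have "\<tau> \<in> K" "e \<noteq> {}" using \<tau> that by (auto simp: faces_def)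
        then show ?thesis using K that(1) unfolding abstract_complex_def by blast
      qed
      then show "edges_on \<tau> \<subseteq> ?E" by (auto simp: edges_on_def faces_def)
    qed (auto simp: edges_on_def faces_def)
    finally show "triangle_sign s \<tau> = 1" unfolding \<chi> triangle_sign_def by simp
  qed
  have "?Z \<noteq> {}" using BZ k_boundaries_zero by auto
  \<comment> \<open>A nonzero value of \<open>card\<close> certifies that the carrier is finite, as
    the dimension formula requires.\<close>
  then have "card (carrier (H1_F2 K)) \<noteq> 0" using cH fZ by (metis card_eq_0_iff mult_0)
  then have "finite (carrier (H1_F2 K))" by (simp add: card_eq_0_iff)
  then have "card (carrier (H1_F2 K)) = card (carrier (class_ring :: bit ring)) ^ dim_H1_F2 K"
    unfolding dim_H1_F2_def H1_F2_def
    by (rule vectorspace.card_carrier_eq_power_dim[OF vectorspace_homology[OF K]])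
  then have "2 ^ dim_H1_F2 K = card (carrier (H1_F2 K))"
    by (simp add: card_UNIV_bit)
  also have "\<dots> \<le> card ?T" by (rule H_T)
  also have "\<dots> \<le> card ?C"
    using finite_sign_functions[OF fE] by (intro card_mono TC) auto
  finally show ?thesis .
qed

section \<open>Integral homology of hypertrees\<close>

lemma homology_carrier_image:
  "carrier (homology K k) = (\<lambda>z. {\<lambda>\<sigma>. b \<sigma> + z \<sigma> |b. b \<in> k_boundaries K k}) ` k_cycles K k"
  by (auto simp: homology_carrier RCOSETS_def r_coset_def cycle_module_def)

lemma homology_class_eq_iff:
  fixes z z' :: "nat set \<Rightarrow> 'r::comm_ring_1"
  shows "{\<lambda>\<sigma>. b \<sigma> + z \<sigma> |b. b \<in> k_boundaries K k} = {\<lambda>\<sigma>. b \<sigma> + z' \<sigma> |b. b \<in> k_boundaries K k} \<longleftrightarrow>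
    (\<lambda>\<sigma>. z \<sigma> - z' \<sigma>) \<in> k_boundaries K k" (is "?C z = ?C z' \<longleftrightarrow> _")
proof
  assume "?C z = ?C z'"
  moreover have "z \<in> ?C z" using k_boundaries_zero[of K k] by force
  ultimately obtain b where "b \<in> k_boundaries K k" "z = (\<lambda>\<sigma>. b \<sigma> + z' \<sigma>)" by auto
  then show "(\<lambda>\<sigma>. z \<sigma> - z' \<sigma>) \<in> k_boundaries K k" by simp
next
  have sub: "?C x \<subseteq> ?C y" if d: "(\<lambda>\<sigma>. x \<sigma> - y \<sigma>) \<in> k_boundaries K k" for x y :: "nat set \<Rightarrow> 'r"
  proof
    fix c assume "c \<in> ?C x"
    then obtain b where b: "b \<in> k_boundaries K k" "c = (\<lambda>\<sigma>. b \<sigma> + x \<sigma>)" by auto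
    then have "c = (\<lambda>\<sigma>. (b \<sigma> + (x \<sigma> - y \<sigma>)) + y \<sigma>)" by simp
    then show "c \<in> ?C y"
      using k_boundaries_add[OF b(1) d] by (intro CollectI exI[of _ "\<lambda>\<sigma>. b \<sigma> + (x \<sigma> - y \<sigma>)"]) simp
  qed
  assume d: "(\<lambda>\<sigma>. z \<sigma> - z' \<sigma>) \<in> k_boundaries K k"
  have "(\<lambda>\<sigma>. z' \<sigma> - z \<sigma>) \<in> k_boundaries K k"
    using k_boundaries_scale[OF d, of "-1"] by simp
  then show "?C z = ?C z'" using sub[OF d] sub by blast
qed

text \<open>Serves to compute in the full simplex, where every triangle is a face, and to carry the
  resulting cycles over to a hypertree.\<close>

lemma boundary_cong_faces:
  assumes K: "abstract_complex K" and L: "abstract_complex L"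
    and k: "faces K k = faces L k" and Sk: "faces K (Suc k) = faces L (Suc k)"
    and c: "c \<in> k_chains K (Suc k)"
  shows "boundary K c = boundary L c"
proof
  fix \<sigma>
  have cL: "c \<in> k_chains L (Suc k)" using c Sk by (simp add: k_chains_def)
  show "boundary K c \<sigma> = boundary L c \<sigma>"
  proof (cases "\<sigma> \<in> faces K k")
    case True
    then show ?thesis using k Sk by (simp add: boundary_incidence[OF K True] boundary_incidence[OF L, of \<sigma> k])
  next
    case False
    then show ?thesis
      using boundary_in_chains[OF K c] boundary_in_chains[OF L cL] k by (simp add: k_chains_def)
  qed
qed

lemma edges_on_insert:
  assumes "x \<notin> A"
  shows "edges_on (insert x A) = edges_on A \<union> (\<lambda>v. {x, v}) ` A"
proof -
  have "e \<in> edges_on A \<union> (\<lambda>v. {x, v}) ` A" if e: "e \<subseteq> insert x A" "card e = 2" for e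
  proof (cases "x \<in> e")
    case True
    obtain u v where uv: "e = {u, v}" "u \<noteq> v" using e by (auto simp: card_2_iff)
    with True have "e = {x, u} \<and> u \<noteq> x \<or> e = {x, v} \<and> v \<noteq> x" by auto
    then show ?thesis using e uv by auto
  qed (use e in \<open>auto simp: edges_on_def\<close>)
  moreover have "card {x, v} = 2" if "v \<in> A" for v
    using assms that by (auto simp: card_2_iff)
  ultimately show ?thesis by (auto simp: edges_on_def)
qed

lemma card_edges_on: "finite A \<Longrightarrow> card (edges_on A) = card A choose 2"
  unfolding edges_on_def by (rule n_subsets)

lemma abstract_complex_simplex: "abstract_complex (Pow {1..n} - {{}})"
  unfolding abstract_complex_def by (auto intro: finite_subset)

section \<open>Cycles of a hypertree and the star of edges at vertex 1\<close>

context
  fixes n S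
  assumes S: "S \<in> hypertrees n"
begin

lemma hypertree_complex: "abstract_complex S"
  using S by (simp add: hypertrees_def two_dim_complex_on_def)

lemma hypertree_face_subset: "\<sigma> \<in> S \<Longrightarrow> \<sigma> \<subseteq> {1..n}"
  using S by (auto simp: hypertrees_def two_dim_complex_on_def)

lemma hypertree_vertices: "faces S 0 = (\<lambda>v. {v}) ` {1..n}"
proof
  show "faces S 0 \<subseteq> (\<lambda>v. {v}) ` {1..n}"
    using hypertree_face_subset by (fastforce simp: faces_def card_1_singleton_iff)
  show "(\<lambda>v. {v}) ` {1..n} \<subseteq> faces S 0"
  proof safe
    fix v assume "v \<in> {1..n}"
    then have "v \<in> \<Union>S" using S by (simp add: hypertrees_def two_dim_complex_on_def)
    then obtain \<sigma> where "\<sigma> \<in> S" "{v} \<subseteq> \<sigma>" by auto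
    then have "{v} \<in> S" using hypertree_complex unfolding abstract_complex_def by blast
    then show "{v} \<in> faces S 0" by (simp add: faces_def)
  qed
qed

lemma hypertree_edges: "faces S 1 = edges_on {1..n}"
  using S hypertree_face_subset by (auto simp: hypertrees_def faces_def edges_on_def)

lemma hypertree_card_triangles: "card (faces S 2) = (n - 1) choose 2"
  using S by (simp add: hypertrees_def)

text \<open>Vertices and edges are forced, so a hypertree is determined by its triangles; this
  identifies hypertrees with column sets.\<close>

lemma hypertree_eq: "S = (\<lambda>v. {v}) ` {1..n} \<union> edges_on {1..n} \<union> faces S 2"
proof -
  have "card \<sigma> \<in> {1, 2, 3}" if "\<sigma> \<in> S" for \<sigma>
  proof -
    have "finite \<sigma>" "\<sigma> \<noteq> {}" using hypertree_complex that by (auto simp: abstract_complex_def)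
    then have "card \<sigma> \<noteq> 0" by simp
    moreover have "card \<sigma> \<le> 3" using S that by (auto simp: hypertrees_def two_dim_complex_on_def)
    ultimately show ?thesis by (auto simp: numeral_3_eq_3 le_Suc_eq)
  qed
  then have "S \<subseteq> faces S 0 \<union> faces S 1 \<union> faces S 2" by (fastforce simp: faces_def)
  moreover have "faces S k \<subseteq> S" for k by (auto simp: faces_def)
  ultimately show ?thesis unfolding hypertree_vertices[symmetric] hypertree_edges[symmetric] by blast
qed

text \<open>The edges at vertex 1 form a star, and a star carries no cycle: the boundary at a leaf
  \<open>v\<close> sees only the coefficient of \<open>{1, v}\<close>. Cycles are thus determined by
  their values on the edges avoiding vertex 1.\<close>

lemma hypertree_cycle_eq_zero:
  fixes d :: "nat set \<Rightarrow> int"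
  assumes d: "d \<in> k_cycles S 1" and z: "\<And>e. e \<in> edges_on {2..n} \<Longrightarrow> d e = 0"
  shows "d = (\<lambda>_. 0)"
proof
  fix e
  show "d e = 0"
  proof (cases "e \<in> faces S 1 \<and> e \<notin> edges_on {2..n}")
    case True
    then obtain v where n: "1 \<in> {1..n}" and v: "v \<in> {2..n}" and e: "e = {1, v}"
    proof -
      have n: "n \<ge> 1" using True hypertree_edges by (auto simp: edges_on_def card_2_iff)
      then have "{1..n} = insert 1 {2..n}" by auto
      then have "e \<in> edges_on (insert 1 {2..n})" using True hypertree_edges by simp
      then show thesis using that True n by (auto simp: edges_on_insert)
    qed
    have fS: "finite (faces S 1)" using hypertree_complex by (simp add: faces_def abstract_complex_def)
    have "{v} \<in> faces S 0" using v hypertree_vertices by auto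
    then have "boundary S d {v} = (\<Sum>\<tau>\<in>faces S 1. incidence {v} \<tau> * d \<tau>)"
      using boundary_incidence[OF hypertree_complex, of "{v}" 0] by simp
    also have "\<dots> = (\<Sum>\<tau>\<in>faces S 1. if \<tau> = e then incidence {v} e * d e else 0)"
    proof (intro sum.cong refl)
      fix \<tau> assume \<tau>: "\<tau> \<in> faces S 1"
      show "incidence {v} \<tau> * d \<tau> = (if \<tau> = e then incidence {v} e * d e else 0)"
      proof (cases "v \<in> \<tau> \<and> \<tau> \<notin> edges_on {2..n}")
        case True
        have "{1..n} = insert 1 {2..n}" using n by auto
        then have "\<tau> \<in> edges_on (insert 1 {2..n})" using \<tau> hypertree_edges by simp
        then have "\<tau> = e" using True v by (auto simp: edges_on_insert e)
        then show ?thesis by simp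
      next
        case False
        moreover have "v \<in> e" by (simp add: e)
        ultimately show ?thesis using z \<open>e \<in> faces S 1 \<and> e \<notin> edges_on {2..n}\<close>
          by (auto simp: incidence_def)
      qed
    qed
    also have "\<dots> = incidence {v} e * d e" using True fS by simp
    finally have "incidence {v} e * d e = 0" using d by (simp add: k_cycles_def)
    moreover have "(incidence {v} e :: int)\<^sup>2 = 1" by (simp add: incidence_square e)
    ultimately show ?thesis by auto
  next
    case False
    then show ?thesis using d z by (auto simp: k_cycles_def k_chains_def)
  qed
qed

text \<open>The cycle is the boundary of the triangle \<open>insert 1 e\<close>, whose other two
  edges contain vertex 1. It is formed in the full simplex because this triangle need not be a face
  of \<open>S\<close>.\<close>

lemma hypertree_cone_cycle:
  assumes e: "e \<in> edges_on {2..n}"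
  obtains z :: "nat set \<Rightarrow> int" where "z \<in> k_cycles S 1" "z e \<noteq> 0"
    "\<And>e'. e' \<in> edges_on {2..n} \<Longrightarrow> e' \<noteq> e \<Longrightarrow> z e' = 0"
proof -
  let ?F = "Pow {1..n} - {{}}"
  have F: "abstract_complex ?F" by (rule abstract_complex_simplex)
  define \<tau> where "\<tau> = insert 1 e"
  have fe: "finite e" and ce: "card e = 2" and en: "e \<subseteq> {2..n}"
    using e by (auto simp: edges_on_def intro: card_ge_0_finite)
  have "n \<ge> 1" using en ce by (cases "n = 0") auto
  then have \<tau>V: "\<tau> \<subseteq> {1..n}" using en by (fastforce simp: \<tau>_def)
  have "1 \<notin> e" using en by auto
  then have c\<tau>: "card \<tau> = 3" using fe ce by (simp add: \<tau>_def)
  then have \<tau>F: "\<tau> \<in> faces ?F 2" using \<tau>V by (auto simp: faces_def)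
  define c :: "nat set \<Rightarrow> int" where "c \<sigma> = (if \<sigma> = \<tau> then 1 else 0)" for \<sigma>
  have c: "c \<in> k_chains ?F (Suc 1)" using \<tau>F by (auto simp: k_chains_def c_def numeral_2_eq_2)
  define z where "z = boundary ?F c"
  have f0: "faces ?F 0 = faces S 0"
    unfolding hypertree_vertices by (auto simp: faces_def card_1_singleton_iff)
  have f1: "faces ?F 1 = faces S 1"
    unfolding hypertree_edges by (auto simp: faces_def edges_on_def)
  have zF: "z \<in> k_chains ?F 1" unfolding z_def by (rule boundary_in_chains[OF F c])
  then have "boundary S z = boundary ?F z"
    using boundary_cong_faces[OF F hypertree_complex, of 0 z] f0 f1 by simp
  also have "\<dots> = (\<lambda>_. 0)" unfolding z_def by (rule boundary_boundary[OF F])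
  finally have "z \<in> k_cycles S 1" using zF f1 by (simp add: k_cycles_def k_chains_def)
  moreover have zi: "z e' = incidence e' \<tau>" if "e' \<in> edges_on {2..n}" for e'
  proof -
    have e'F: "e' \<in> faces ?F 1" using that by (auto simp: edges_on_def faces_def)
    have fin: "finite (faces ?F 2)" by (auto simp: faces_def)
    have "z e' = (\<Sum>\<tau>'\<in>faces ?F 2. incidence e' \<tau>' * c \<tau>')"
      unfolding z_def boundary_incidence[OF F e'F] by (simp add: numeral_2_eq_2)
    also have "\<dots> = (\<Sum>\<tau>'\<in>faces ?F 2. if \<tau>' = \<tau> then incidence e' \<tau> else 0)"
      by (intro sum.cong) (auto simp: c_def)
    also have "\<dots> = incidence e' \<tau>" using \<tau>F fin by simp
    finally show ?thesis .
  qed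
  moreover have "(incidence e \<tau> :: int)\<^sup>2 = 1" by (auto simp: incidence_square \<tau>_def)
  then have "z e \<noteq> 0" using zi[OF e] by auto
  moreover have "z e' = 0" if "e' \<in> edges_on {2..n}" "e' \<noteq> e" for e'
  proof -
    have "\<not> e' \<subseteq> \<tau>"
    proof
      assume "e' \<subseteq> \<tau>"
      then have "e' \<subseteq> e" using that(1) by (auto simp: \<tau>_def edges_on_def)
      then have "e' = e" using fe ce that(1) by (intro card_subset_eq) (auto simp: edges_on_def)
      then show False using that(2) by simp
    qed
    then show ?thesis using zi[OF that(1)] by (simp add: incidence_def)
  qed
  ultimately show thesis using that by blast
qed

text \<open>Restricting a cycle to the edges avoiding vertex 1 embeds the homology group into the
  integer vectors modulo the column lattice of the incidence matrix, by
  \<open>hypertree_cycle_eq_zero\<close>. Finiteness of the homology supplies the torsion needed for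
  \<open>lattice_index_le_det\<close>.\<close>

lemma card_H1_int_le_det:
  assumes \<epsilon>: "bij_betw \<epsilon> {..<m} (edges_on {2..n})" and \<phi>: "bij_betw \<phi> {..<m} (faces S 2)"
  shows "int (card (carrier (H1_int S))) \<le> \<bar>det (mat m m (\<lambda>(i, j). incidence (\<epsilon> i) (\<phi> j)))\<bar>"
proof -
  define A where "A i j = (incidence (\<epsilon> i) (\<phi> j) :: int)" for i j
  define cls where "cls z = {\<lambda>\<sigma>. b \<sigma> + z \<sigma> |b. b \<in> k_boundaries S 1}" for z :: "nat set \<Rightarrow> int"
  have carr: "carrier (H1_int S) = cls ` k_cycles S 1"
    unfolding H1_int_def homology_carrier_image cls_def ..
  have cls_eq: "cls z = cls z' \<longleftrightarrow> (\<lambda>\<sigma>. z \<sigma> - z' \<sigma>) \<in> k_boundaries S 1" for z z'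
    unfolding cls_def by (rule homology_class_eq_iff)
  have fin: "finite (carrier (H1_int S))" using S by (simp add: hypertrees_def)
  have bd: "boundary S c (\<epsilon> i) = (\<Sum>j<m. A i j * c (\<phi> j))" if "i < m" for c i
  proof -
    have "\<epsilon> i \<in> edges_on {2..n}" using \<epsilon> that by (auto simp: bij_betw_def)
    then have "\<epsilon> i \<in> faces S 1" unfolding hypertree_edges by (auto simp: edges_on_def)
    then have "boundary S c (\<epsilon> i) = (\<Sum>\<tau>\<in>faces S 2. incidence (\<epsilon> i) \<tau> * c \<tau>)"
      by (subst boundary_incidence[OF hypertree_complex]) (auto simp: numeral_2_eq_2)
    also have "\<dots> = (\<Sum>j<m. A i j * c (\<phi> j))"
      unfolding A_def by (rule sum.reindex_bij_betw[OF \<phi>, symmetric])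
    finally show ?thesis .
  qed
  have tors: "\<exists>k\<noteq>0. in_lattice m A (\<lambda>j. if j = i then k else 0)" if i: "i < m" for i
  proof -
    have \<epsilon>i: "\<epsilon> i \<in> edges_on {2..n}" using \<epsilon> i by (auto simp: bij_betw_def)
    obtain z :: "nat set \<Rightarrow> int" where z: "z \<in> k_cycles S 1" "z (\<epsilon> i) \<noteq> 0"
      and z0: "\<And>e'. e' \<in> edges_on {2..n} \<Longrightarrow> e' \<noteq> \<epsilon> i \<Longrightarrow> z e' = 0"
      using hypertree_cone_cycle[OF \<epsilon>i] by blast
    \<comment> \<open>Pigeonhole: the integer multiples of \<open>z\<close> fall into finitely many
      classes, so two distinct multiples differ by a boundary. Its values on the edges avoiding
      vertex 1 are a nonzero multiple of a unit vector.\<close>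
    have "(\<lambda>\<sigma>. a * z \<sigma>) \<in> k_cycles S 1" for a
      using z(1) by (simp add: k_cycles_def k_chains_def boundary_scale)
    then have "range (\<lambda>a. cls (\<lambda>\<sigma>. a * z \<sigma>)) \<subseteq> carrier (H1_int S)" unfolding carr by auto
    then have "finite (range (\<lambda>a. cls (\<lambda>\<sigma>. a * z \<sigma>)))" using fin by (rule finite_subset)
    then have "\<not> inj (\<lambda>a. cls (\<lambda>\<sigma>. a * z \<sigma>))" using finite_imageD infinite_UNIV_int by blast
    then obtain a b where ab: "a \<noteq> b" "cls (\<lambda>\<sigma>. a * z \<sigma>) = cls (\<lambda>\<sigma>. b * z \<sigma>)"
      by (auto simp: inj_def)
    then obtain c where c: "(\<lambda>\<sigma>. a * z \<sigma> - b * z \<sigma>) = boundary S c"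
      unfolding cls_eq k_boundaries_def by blast
    have "(if j = i then (a - b) * z (\<epsilon> i) else 0) = (\<Sum>l<m. A j l * c (\<phi> l))" if j: "j < m" for j
    proof -
      have "(a - b) * z (\<epsilon> j) = boundary S c (\<epsilon> j)"
        unfolding c[symmetric] by (simp add: left_diff_distrib)
      moreover have "z (\<epsilon> j) = 0" if "j \<noteq> i"
        using \<epsilon> i j that by (intro z0) (auto simp: bij_betw_def inj_on_def)
      ultimately show ?thesis using bd[OF j, of c] by auto
    qed
    then have "in_lattice m A (\<lambda>j. if j = i then (a - b) * z (\<epsilon> i) else 0)"
      unfolding in_lattice_def by (intro exI[of _ "\<lambda>l. c (\<phi> l)"]) simp
    then show ?thesis using ab(1) z(2) by (intro exI[of _ "(a - b) * z (\<epsilon> i)"]) simp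
  qed
  obtain R where R: "finite R" "int (card R) \<le> \<bar>det (mat m m (\<lambda>(i, j). A i j))\<bar>"
    and rep: "\<And>x. \<exists>r\<in>R. in_lattice m A (\<lambda>i. x i - r i)"
    using lattice_index_le_det[OF tors] by blast
  have same: "cls z = cls z'" if z: "z \<in> k_cycles S 1" and z': "z' \<in> k_cycles S 1"
    and r: "in_lattice m A (\<lambda>i. z (\<epsilon> i) - r i)" and r': "in_lattice m A (\<lambda>i. z' (\<epsilon> i) - r i)" for z z' r
  proof -
    have "in_lattice m A (\<lambda>i. (z (\<epsilon> i) - r i) - 1 * (z' (\<epsilon> i) - r i))"
      by (rule in_lattice_lincomb[OF r r'])
    then obtain y where y: "\<And>i. i < m \<Longrightarrow> z (\<epsilon> i) - z' (\<epsilon> i) = (\<Sum>j<m. A i j * y j)"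
      unfolding in_lattice_def by auto
    \<comment> \<open>The lattice coefficients \<open>y\<close>, transported to the triangles, form
      a 2-chain whose boundary agrees with the difference of the two cycles off vertex 1.\<close>
    define c where "c \<tau> = (if \<tau> \<in> faces S 2 then y (inv_into {..<m} \<phi> \<tau>) else 0)" for \<tau>
    have c: "c \<in> k_chains S (Suc 1)" by (simp add: c_def k_chains_def numeral_2_eq_2)
    have c\<phi>: "c (\<phi> j) = y j" if "j < m" for j
      using \<phi> that by (auto simp: c_def bij_betw_def inv_into_f_f)
    have bc: "boundary S c \<in> k_boundaries S 1" using c by (simp add: k_boundaries_def)
    \<comment> \<open>The difference is written with a scaling by \<open>-1\<close> so that
      \<open>boundary_add\<close> and \<open>boundary_scale\<close> apply.\<close>
    define d where "d = (\<lambda>\<sigma>. z \<sigma> + (-1) * (z' \<sigma> + boundary S c \<sigma>))"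
    have "boundary S c \<in> k_cycles S 1"
      using bc k_boundaries_subset_cycles[OF hypertree_complex] by blast
    then have "d \<in> k_cycles S 1"
      using z z' unfolding d_def k_cycles_def mem_Collect_eq boundary_add boundary_scale
      by (simp add: k_chains_def)
    moreover have "d e = 0" if e: "e \<in> edges_on {2..n}" for e
    proof -
      obtain i where i: "i < m" "e = \<epsilon> i" using \<epsilon> e by (auto simp: bij_betw_def)
      then show ?thesis using y[OF i(1)] bd[OF i(1), of c] c\<phi> by (simp add: d_def)
    qed
    ultimately have "d = (\<lambda>_. 0)" by (rule hypertree_cycle_eq_zero)
    then have "z \<sigma> - z' \<sigma> = boundary S c \<sigma>" for \<sigma>
      by (auto simp: d_def fun_eq_iff algebra_simps)
    then show ?thesis using bc unfolding cls_eq by simp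
  qed
  \<comment> \<open>A cycle is fixed for every homology class; sending the class to the
    representative in \<open>R\<close> of that cycle is injective by \<open>same\<close>.\<close>
  define zc where "zc = inv_into (k_cycles S 1) cls"
  have zc: "zc X \<in> k_cycles S 1 \<and> cls (zc X) = X" if "X \<in> carrier (H1_int S)" for X
    using that unfolding zc_def carr by (simp add: inv_into_into f_inv_into_f)
  obtain r where r: "\<And>x. r x \<in> R" "\<And>x. in_lattice m A (\<lambda>i. x i - r x i)"
    using rep by metis
  have "inj_on (\<lambda>X. r (\<lambda>i. zc X (\<epsilon> i))) (carrier (H1_int S))"
  proof (rule inj_onI)
    fix X Y assume X: "X \<in> carrier (H1_int S)" and Y: "Y \<in> carrier (H1_int S)"
      and eq: "r (\<lambda>i. zc X (\<epsilon> i)) = r (\<lambda>i. zc Y (\<epsilon> i))"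
    have "cls (zc X) = cls (zc Y)"
      using same[of "zc X" "zc Y" "r (\<lambda>i. zc Y (\<epsilon> i))"] zc[OF X] zc[OF Y]
        r(2)[of "\<lambda>i. zc X (\<epsilon> i)"] r(2)[of "\<lambda>i. zc Y (\<epsilon> i)"] eq by simp
    then show "X = Y" using zc[OF X] zc[OF Y] by simp
  qed
  then have "card (carrier (H1_int S)) \<le> card R"
    using r(1) R(1) by (intro card_inj_on_le) auto
  then show ?thesis using R(2) by (simp add: A_def)
qed

end

section \<open>The tail estimate\<close>

lemma det_incidence_of_int:
  "det (mat m m (\<lambda>(i, j). incidence (\<epsilon> i) (\<phi> j) :: real)) =
    of_int (det (mat m m (\<lambda>(i, j). incidence (\<epsilon> i) (\<phi> j))))"
proof -
  have "mat m m (\<lambda>(i, j). incidence (\<epsilon> i) (\<phi> j) :: real) =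
      map_mat of_int (mat m m (\<lambda>(i, j). incidence (\<epsilon> i) (\<phi> j)))"
    by (rule eq_matI) (simp_all add: incidence_def)
  then show ?thesis by (simp add: of_int_hom.hom_det)
qed

lemma finite_hypertrees: "finite (hypertrees n)"
  by (rule finite_subset[of _ "Pow (Pow {1..n})"]) (use hypertree_face_subset in auto)

lemma inj_on_hypertree_triangles: "inj_on (\<lambda>S. faces S 2) (hypertrees n)"
  by (rule inj_onI) (metis hypertree_eq)

text \<open>The rows are the edges avoiding vertex 1, as many as a hypertree has triangles, so each
  hypertree gives a square minor. The squared norm of row \<open>e\<close> over the columns
  \<open>X\<close> is the degree of \<open>e\<close> in \<open>X\<close>.\<close>

lemma sum_card_H1_int_square_le:
  assumes X: "X \<subseteq> {\<tau>. \<tau> \<subseteq> {1..n} \<and> card \<tau> = 3}"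
  shows "(\<Sum>S | S \<in> hypertrees n \<and> faces S 2 \<subseteq> X. (real (card (carrier (H1_int S))))\<^sup>2) \<le>
    (\<Prod>e\<in>edges_on {2..n}. real (card {\<tau> \<in> X. e \<subseteq> \<tau>}))"
proof -
  define m where "m = card (edges_on {2..n})"
  have m: "m = (n - 1) choose 2" by (simp add: m_def card_edges_on)
  have fX: "finite X" by (rule finite_subset[OF X]) auto
  obtain \<epsilon> where \<epsilon>: "bij_betw \<epsilon> {..<m} (edges_on {2..n})"
    unfolding m_def using ex_bij_betw_nat_finite[OF finite_edges_on, of "{2..n}"]
    by (auto simp: atLeast0LessThan)
  have "(\<Sum>S | S \<in> hypertrees n \<and> faces S 2 \<subseteq> X. (real (card (carrier (H1_int S))))\<^sup>2) \<le>
      (\<Prod>i<m. \<Sum>\<tau>\<in>X. (incidence (\<epsilon> i) \<tau>)\<^sup>2)"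
  proof (rule sum_minors_le[where F = "\<lambda>S. faces S 2", OF fX])
    show "inj_on (\<lambda>S. faces S 2) {S. S \<in> hypertrees n \<and> faces S 2 \<subseteq> X}"
      by (rule inj_on_subset[OF inj_on_hypertree_triangles]) auto
  next
    fix S assume "S \<in> {S. S \<in> hypertrees n \<and> faces S 2 \<subseteq> X}"
    then have S: "S \<in> hypertrees n" by simp
    show "card (faces S 2) = m" using hypertree_card_triangles[OF S] m by simp
    fix \<phi> assume \<phi>: "bij_betw \<phi> {..<m} (faces S 2)"
    have "real_of_int (int (card (carrier (H1_int S)))) \<le>
        real_of_int \<bar>det (mat m m (\<lambda>(i, j). incidence (\<epsilon> i) (\<phi> j)))\<bar>"
      using card_H1_int_le_det[OF S \<epsilon> \<phi>] by (simp only: of_int_le_iff)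
    then have "real (card (carrier (H1_int S))) \<le>
        \<bar>det (mat m m (\<lambda>(i, j). incidence (\<epsilon> i) (\<phi> j) :: real))\<bar>"
      unfolding det_incidence_of_int by simp
    then show "(real (card (carrier (H1_int S))))\<^sup>2 \<le>
        (det (mat m m (\<lambda>(i, j). incidence (\<epsilon> i) (\<phi> j))))\<^sup>2"
      by (metis abs_ge_zero of_nat_0_le_iff power2_abs power_mono)
  qed auto
  also have "\<dots> = (\<Prod>i<m. real (card {\<tau> \<in> X. \<epsilon> i \<subseteq> \<tau>}))"
    using fX by (simp add: incidence_square sum.If_cases Int_def)
  also have "\<dots> = (\<Prod>e\<in>edges_on {2..n}. real (card {\<tau> \<in> X. e \<subseteq> \<tau>}))"
    by (rule prod.reindex_bij_betw[OF \<epsilon>])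
  finally show ?thesis .
qed

lemma triangle_sign_insert:
  assumes e: "card e = 2" and w: "w \<notin> e"
  shows "triangle_sign s (insert w e) = s e * link_sign s e w"
proof -
  obtain u v where uv: "e = {u, v}" "u \<noteq> v" using e by (auto simp: card_2_iff)
  have fe: "finite e" using e by (intro card_ge_0_finite) simp
  have "e' = e" if "e' \<subseteq> e" "card e' = 2" for e'
    using card_subset_eq[OF fe that(1)] that(2) e by simp
  then have "edges_on e = {e}"
    unfolding edges_on_def using e by blast
  then have "edges_on (insert w e) = {e, {w, u}, {w, v}}"
    using edges_on_insert[OF w] uv by auto
  moreover have "e \<noteq> {w, u}" "e \<noteq> {w, v}" "{w, u} \<noteq> {w, v}"
    using uv w by (auto simp: doubleton_eq_iff)
  ultimately show ?thesis
    using uv w by (auto simp: triangle_sign_def link_sign_def edge_sign_def insert_commute)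
qed

text \<open>A triangle through \<open>e\<close> is given by its apex \<open>w\<close> and has sign
  \<open>s e * link_sign s e w\<close>; the indicator that a sign \<open>x\<close> equals 1 is
  \<open>(1 + x) / 2\<close>. The bound is not an equality because the two degenerate choices
  \<open>w \<in> e\<close> are counted as well.\<close>

lemma card_even_triangles_le:
  assumes V: "finite V" and s: "s \<in> sign_functions (edges_on V)" and e: "e \<in> edges_on V"
  shows "real (card {\<tau>. \<tau> \<subseteq> V \<and> card \<tau> = 3 \<and> triangle_sign s \<tau> = 1 \<and> e \<subseteq> \<tau>}) \<le>
    real (card V) / 2 * (1 + s e * ((\<Sum>w\<in>V. link_sign s e w) / card V))"
proof -
  let ?W = "{w \<in> V. s e * link_sign s e w = 1}"
  have eV: "e \<subseteq> V" and ce: "card e = 2" using e by (auto simp: edges_on_def)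
  have fe: "finite e" using ce by (intro card_ge_0_finite) simp
  have "{\<tau>. \<tau> \<subseteq> V \<and> card \<tau> = 3 \<and> triangle_sign s \<tau> = 1 \<and> e \<subseteq> \<tau>} \<subseteq> (\<lambda>w. insert w e) ` ?W"
  proof
    fix \<tau> assume "\<tau> \<in> {\<tau>. \<tau> \<subseteq> V \<and> card \<tau> = 3 \<and> triangle_sign s \<tau> = 1 \<and> e \<subseteq> \<tau>}"
    then have \<tau>: "\<tau> \<subseteq> V" "card \<tau> = 3" "triangle_sign s \<tau> = 1" "e \<subseteq> \<tau>" by auto
    then have "card (\<tau> - e) = 1" using fe ce by (simp add: card_Diff_subset)
    then obtain w where "\<tau> - e = {w}" by (auto simp: card_1_singleton_iff)
    then have w: "\<tau> = insert w e" "w \<notin> e" using \<tau> by auto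
    then have "w \<in> ?W" using \<tau> triangle_sign_insert[OF ce w(2), of s] by auto
    then show "\<tau> \<in> (\<lambda>w. insert w e) ` ?W" using w by auto
  qed
  then have "card {\<tau>. \<tau> \<subseteq> V \<and> card \<tau> = 3 \<and> triangle_sign s \<tau> = 1 \<and> e \<subseteq> \<tau>} \<le> card ?W"
    using V by (intro surj_card_le) auto
  then have "real (card {\<tau>. \<tau> \<subseteq> V \<and> card \<tau> = 3 \<and> triangle_sign s \<tau> = 1 \<and> e \<subseteq> \<tau>}) \<le> real (card ?W)"
    by simp
  also have "\<dots> = (\<Sum>w\<in>V. if s e * link_sign s e w = 1 then 1 else 0)"
    using V by (simp add: sum.If_cases Int_def)
  also have "\<dots> = (\<Sum>w\<in>V. (1 + s e * link_sign s e w) / 2)"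
  proof (intro sum.cong refl)
    fix w assume w: "w \<in> V"
    have "s e \<in> {-1, 1}" using s e by (auto simp: sign_functions_def PiE_iff)
    then show "(if s e * link_sign s e w = 1 then 1 else 0) = (1 + s e * link_sign s e w) / 2"
      using link_sign_values[OF s e w] by auto
  qed
  also have "\<dots> = (real (card V) + s e * (\<Sum>w\<in>V. link_sign s e w)) / 2"
    by (simp add: sum_divide_distrib[symmetric] sum.distrib sum_distrib_left)
  also have "\<dots> = real (card V) / 2 * (1 + s e * ((\<Sum>w\<in>V. link_sign s e w) / card V))"
    using V by (cases "V = {}") (auto simp: field_simps)
  finally show ?thesis .
qed

text \<open>The power of 2 is replaced by a count of cocycles \<open>s\<close> and the sums are
  exchanged. For fixed \<open>s\<close> the remaining sum over hypertrees is a sum of squared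
  minors, bounded by a product of degrees, and \<open>sum_prod_link_signs_le\<close> sums these
  products over \<open>s\<close>.\<close>

lemma sum_two_power_dim_le:
  assumes n: "n \<ge> 1" and q: "q > (0::nat)"
  shows "(\<Sum>S\<in>hypertrees n. 2 ^ dim_H1_F2 S * (real (card (carrier (H1_int S))))\<^sup>2) \<le>
    real n ^ ((n - 1) choose 2) * 2 ^ (n * q ^ 4 + (n - 1)) * exp (2 * ((n - 1) choose 2) / q)"
proof -
  let ?V = "{1..n}"
  let ?S = "sign_functions (edges_on ?V)"
  let ?E' = "edges_on {2..n}"
  let ?h = "\<lambda>S. (real (card (carrier (H1_int S))))\<^sup>2"
  define m where "m = (n - 1) choose 2"
  define X where "X s = {\<tau>. \<tau> \<subseteq> ?V \<and> card \<tau> = 3 \<and> triangle_sign s \<tau> = 1}" for s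
  have fS: "finite ?S" by (simp add: finite_sign_functions finite_edges_on)
  have fH: "finite (hypertrees n)" by (rule finite_hypertrees)
  have E'E: "?E' \<subseteq> edges_on ?V" by (auto simp: edges_on_def)
  have m: "card ?E' = m" by (simp add: card_edges_on m_def)
  have cE: "card (edges_on ?V) = m + (n - 1)"
    using n by (cases n) (simp_all add: card_edges_on m_def numeral_2_eq_2)
  have "(\<Sum>S\<in>hypertrees n. 2 ^ dim_H1_F2 S * ?h S) \<le>
      (\<Sum>S\<in>hypertrees n. \<Sum>s\<in>?S. if faces S 2 \<subseteq> X s then ?h S else 0)"
  proof (rule sum_mono)
    fix S assume S: "S \<in> hypertrees n"
    have "faces S 2 \<subseteq> {\<tau>. \<tau> \<subseteq> ?V \<and> card \<tau> = 3}"
      using hypertree_face_subset[OF S] by (auto simp: faces_def)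
    then have X_iff: "(\<forall>\<tau>\<in>faces S 2. triangle_sign s \<tau> = 1) \<longleftrightarrow> faces S 2 \<subseteq> X s" for s
      by (auto simp: X_def)
    have "2 ^ dim_H1_F2 S \<le> card {s \<in> ?S. faces S 2 \<subseteq> X s}"
      using two_power_dim_H1_F2_le[OF hypertree_complex[OF S]]
      unfolding X_iff hypertree_edges[OF S] .
    then have "real (2 ^ dim_H1_F2 S) \<le> real (card {s \<in> ?S. faces S 2 \<subseteq> X s})"
      by (simp only: of_nat_le_iff)
    then have "2 ^ dim_H1_F2 S * ?h S \<le> real (card {s \<in> ?S. faces S 2 \<subseteq> X s}) * ?h S"
      by (intro mult_right_mono) auto
    also have "\<dots> = (\<Sum>s\<in>?S. if faces S 2 \<subseteq> X s then ?h S else 0)"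
      using fS by (simp add: sum.If_cases Int_def)
    finally show "2 ^ dim_H1_F2 S * ?h S \<le> (\<Sum>s\<in>?S. if faces S 2 \<subseteq> X s then ?h S else 0)" .
  qed
  also have "\<dots> = (\<Sum>s\<in>?S. \<Sum>S\<in>hypertrees n. if faces S 2 \<subseteq> X s then ?h S else 0)"
    by (rule sum.swap)
  also have "\<dots> = (\<Sum>s\<in>?S. \<Sum>S | S \<in> hypertrees n \<and> faces S 2 \<subseteq> X s. ?h S)"
    using fH by (simp add: sum.If_cases Int_def)
  also have "\<dots> \<le> (\<Sum>s\<in>?S. \<Prod>e\<in>?E'. n / 2 * (1 + s e * ((\<Sum>w\<in>?V. link_sign s e w) / card ?V)))"
  proof (rule sum_mono)
    fix s assume s: "s \<in> ?S"
    have "(\<Sum>S | S \<in> hypertrees n \<and> faces S 2 \<subseteq> X s. ?h S) \<le> (\<Prod>e\<in>?E'. real (card {\<tau> \<in> X s. e \<subseteq> \<tau>}))"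
      by (rule sum_card_H1_int_square_le) (auto simp: X_def)
    also have "\<dots> \<le> (\<Prod>e\<in>?E'. n / 2 * (1 + s e * ((\<Sum>w\<in>?V. link_sign s e w) / card ?V)))"
    proof (intro prod_mono conjI)
      fix e assume "e \<in> ?E'"
      then have "e \<in> edges_on ?V" using E'E by blast
      from card_even_triangles_le[OF finite_atLeastAtMost s this]
      show "real (card {\<tau> \<in> X s. e \<subseteq> \<tau>}) \<le> n / 2 * (1 + s e * ((\<Sum>w\<in>?V. link_sign s e w) / card ?V))"
        by (simp add: X_def conj_assoc)
    qed simp
    finally show "(\<Sum>S | S \<in> hypertrees n \<and> faces S 2 \<subseteq> X s. ?h S) \<le>
      (\<Prod>e\<in>?E'. n / 2 * (1 + s e * ((\<Sum>w\<in>?V. link_sign s e w) / card ?V)))" .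
  qed
  also have "\<dots> = (n / 2) ^ m * (\<Sum>s\<in>?S. \<Prod>e\<in>?E'. 1 + s e * ((\<Sum>w\<in>?V. link_sign s e w) / card ?V))"
    by (simp only: prod.distrib prod_constant m sum_distrib_left)
  also have "\<dots> \<le> (n / 2) ^ m * (2 ^ (card ?V * q ^ 4) * 2 ^ card (edges_on ?V) * exp (2 * card ?E' / q))"
    using n by (intro mult_left_mono sum_prod_link_signs_le q E'E) auto
  \<comment> \<open>Of the \<open>m + (n - 1)\<close> factors 2 from the sign choices,
    \<open>m\<close> cancel against the halves in the degree bounds; the \<open>n - 1\<close> edges
    at vertex 1 leave the rest.\<close>
  also have "\<dots> = real n ^ m * 2 ^ (n * q ^ 4 + (n - 1)) * exp (2 * m / q)"
    unfolding cE m by (simp add: power_divide power_add)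
  finally show ?thesis by (simp add: m_def)
qed

text \<open>Markov's inequality for the exponential moment, applied to the explicit point
  probabilities. The large powers of \<open>n\<close> in the moment bound and in Kalai's
  normalisation almost cancel.\<close>

lemma determinantal_hypertree_tail:
  assumes T: "determinantal_hypertree n M T" and n: "n \<ge> 3" and q: "q > 0" and \<epsilon>: "\<epsilon> > (0::real)"
  shows "measure M {\<omega> \<in> space M. \<bar>real (dim_H1_F2 (T \<omega>)) / (real n)\<^sup>2\<bar> > \<epsilon>} \<le>
    2 powr (- \<epsilon> * (real n)\<^sup>2) * (real n ^ n * 2 ^ (n * q ^ 4 + n) * exp ((real n)\<^sup>2 / real q))"
proof -
  let ?h = "\<lambda>S. (real (card (carrier (H1_int S))))\<^sup>2"
  let ?N = "real n ^ ((n - 2) choose 2)"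
  interpret prob_space M using T by (simp add: determinantal_hypertree_def)
  have meas: "T \<in> M \<rightarrow>\<^sub>M count_space (hypertrees n)"
    and pr: "\<And>S. S \<in> hypertrees n \<Longrightarrow> measure M {\<omega> \<in> space M. T \<omega> = S} = ?h S / ?N"
    using T by (auto simp: determinantal_hypertree_def)
  define D where "D = {S \<in> hypertrees n. \<bar>real (dim_H1_F2 S) / (real n)\<^sup>2\<bar> > \<epsilon>}"
  have fD: "finite D" using finite_hypertrees by (simp add: D_def)
  have TS: "T \<omega> \<in> hypertrees n" if "\<omega> \<in> space M" for \<omega>
    using measurable_space[OF meas that] by simp
  have "{\<omega> \<in> space M. \<bar>real (dim_H1_F2 (T \<omega>)) / (real n)\<^sup>2\<bar> > \<epsilon>} = (\<Union>S\<in>D. {\<omega> \<in> space M. T \<omega> = S})"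
    using TS by (auto simp: D_def)
  also have "measure M \<dots> = (\<Sum>S\<in>D. measure M {\<omega> \<in> space M. T \<omega> = S})"
  proof (rule finite_measure_finite_Union[OF fD])
    have "{\<omega> \<in> space M. T \<omega> = S} \<in> sets M" if "S \<in> D" for S
    proof -
      have "T -` {S} \<inter> space M \<in> sets M"
        using that by (intro measurable_sets[OF meas]) (auto simp: D_def)
      moreover have "T -` {S} \<inter> space M = {\<omega> \<in> space M. T \<omega> = S}" by auto
      ultimately show ?thesis by simp
    qed
    then show "(\<lambda>S. {\<omega> \<in> space M. T \<omega> = S}) ` D \<subseteq> sets M" by auto
  qed (auto simp: disjoint_family_on_def)
  also have "\<dots> = (\<Sum>S\<in>D. ?h S / ?N)"
    by (intro sum.cong refl pr) (auto simp: D_def)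
  \<comment> \<open>On \<open>D\<close> the dimension exceeds the threshold, so the inserted factor
    is at least 1.\<close>
  also have "\<dots> \<le> (\<Sum>S\<in>D. 2 powr (- \<epsilon> * (real n)\<^sup>2) * (2 ^ dim_H1_F2 S * ?h S / ?N))"
  proof (rule sum_mono)
    fix S assume "S \<in> D"
    then have "\<epsilon> * (real n)\<^sup>2 < dim_H1_F2 S" using n by (simp add: D_def field_simps)
    then have "1 \<le> 2 powr (- \<epsilon> * (real n)\<^sup>2 + dim_H1_F2 S)" by (intro ge_one_powr_ge_zero) auto
    also have "\<dots> = 2 powr (- \<epsilon> * (real n)\<^sup>2) * 2 ^ dim_H1_F2 S"
      by (simp only: powr_add) (simp add: powr_realpow)
    finally have "1 * (?h S / ?N) \<le> 2 powr (- \<epsilon> * (real n)\<^sup>2) * 2 ^ dim_H1_F2 S * (?h S / ?N)"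
      by (intro mult_right_mono) auto
    then show "?h S / ?N \<le> 2 powr (- \<epsilon> * (real n)\<^sup>2) * (2 ^ dim_H1_F2 S * ?h S / ?N)"
      by (simp add: mult.assoc)
  qed
  also have "\<dots> \<le> (\<Sum>S\<in>hypertrees n. 2 powr (- \<epsilon> * (real n)\<^sup>2) * (2 ^ dim_H1_F2 S * ?h S / ?N))"
    using finite_hypertrees by (intro sum_mono2) (auto simp: D_def)
  also have "\<dots> = 2 powr (- \<epsilon> * (real n)\<^sup>2) * ((\<Sum>S\<in>hypertrees n. 2 ^ dim_H1_F2 S * ?h S) / ?N)"
    by (simp add: sum_distrib_left sum_divide_distrib)
  also have "\<dots> \<le> 2 powr (- \<epsilon> * (real n)\<^sup>2) * (real n ^ n * 2 ^ (n * q ^ 4 + n) * exp ((real n)\<^sup>2 / real q))"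
  proof (rule mult_left_mono)
    \<comment> \<open>Pascal's rule: after division by Kalai's constant only \<open>n - 2\<close>
      factors \<open>n\<close> remain.\<close>
    have ch: "(n - 1) choose 2 = ((n - 2) choose 2) + (n - 2)"
    proof -
      obtain k where "n = 3 + k" using le_Suc_ex[OF n] by blast
      then show ?thesis by (simp add: numeral_2_eq_2 numeral_3_eq_3)
    qed
    have pw: "real n ^ ((n - 1) choose 2) = ?N * real n ^ (n - 2)"
      by (simp only: ch power_add)
    have "(\<Sum>S\<in>hypertrees n. 2 ^ dim_H1_F2 S * ?h S) / ?N \<le>
      real n ^ ((n - 1) choose 2) * 2 ^ (n * q ^ 4 + (n - 1)) * exp (2 * ((n - 1) choose 2) / q) / ?N"
      using sum_two_power_dim_le[of n q] n q by (intro divide_right_mono) auto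
    also have "\<dots> = real n ^ (n - 2) * 2 ^ (n * q ^ 4 + (n - 1)) * exp (2 * ((n - 1) choose 2) / q)"
      unfolding pw using n by simp
    also have "\<dots> \<le> real n ^ n * 2 ^ (n * q ^ 4 + n) * exp ((real n)\<^sup>2 / real q)"
    proof (intro mult_mono)
      show "real n ^ (n - 2) \<le> real n ^ n" using n by (intro power_increasing) auto
      show "(2::real) ^ (n * q ^ 4 + (n - 1)) \<le> 2 ^ (n * q ^ 4 + n)" by (intro power_increasing) auto
      have "2 * ((n - 1) choose 2) \<le> n\<^sup>2"
      proof -
        have "2 * ((n - 1) choose 2) \<le> (n - 1) * (n - 1 - 1)" by (simp add: choose_two)
        also have "\<dots> \<le> n * n" by (intro mult_mono) auto
        finally show ?thesis by (simp add: power2_eq_square)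
      qed
      then have "real (2 * ((n - 1) choose 2)) \<le> (real n)\<^sup>2"
        by (metis of_nat_le_iff of_nat_power)
      then show "exp (2 * ((n - 1) choose 2) / q) \<le> exp ((real n)\<^sup>2 / real q)"
        by (simp add: divide_right_mono)
    qed auto
    finally show "(\<Sum>S\<in>hypertrees n. 2 ^ dim_H1_F2 S * ?h S) / ?N \<le>
      real n ^ n * 2 ^ (n * q ^ 4 + n) * exp ((real n)\<^sup>2 / real q)" .
  qed simp
  finally show ?thesis .
qed

lemma tail_bound_tendsto_zero:
  assumes "1 / real q < \<epsilon> * ln 2"
  shows "(\<lambda>n. 2 powr (- \<epsilon> * (real n)\<^sup>2) *
    (real n ^ n * 2 ^ (n * q ^ 4 + n) * exp ((real n)\<^sup>2 / real q))) \<longlonglongrightarrow> 0"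
proof -
  \<comment> \<open>After taking logarithms the bound has quadratic coefficient
    \<open>- \<delta>\<close>; the other terms are of order \<open>n * ln n\<close> and
    \<open>n\<close>, with \<open>C\<close> collecting the linear part.\<close>
  define \<delta> where "\<delta> = \<epsilon> * ln 2 - 1 / real q"
  define C where "C = (real q ^ 4 + 1) * ln 2"
  have pos: "\<delta> > 0" using assms by (simp add: \<delta>_def)
  have lim: "(\<lambda>n. exp (real n * ln (real n) + C * real n - \<delta> * (real n)\<^sup>2)) \<longlonglongrightarrow> 0"
    using pos by real_asymp
  have eq: "exp (real n * ln (real n) + C * real n - \<delta> * (real n)\<^sup>2) =
      2 powr (- \<epsilon> * (real n)\<^sup>2) * (real n ^ n * 2 ^ (n * q ^ 4 + n) * exp ((real n)\<^sup>2 / real q))"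
    if n: "n > 0" for n
  proof -
    have "real n ^ n = exp (real n * ln (real n))"
      using n by (simp add: exp_of_nat_mult)
    moreover have "(2::real) ^ (n * q ^ 4 + n) = exp (C * real n)"
    proof -
      have "(2::real) ^ (n * q ^ 4 + n) = exp (real (n * q ^ 4 + n) * ln 2)"
        unfolding exp_of_nat_mult by simp
      then show ?thesis by (simp add: C_def algebra_simps)
    qed
    moreover have "2 powr (- \<epsilon> * (real n)\<^sup>2) = exp (- \<epsilon> * (real n)\<^sup>2 * ln 2)"
      by (simp add: powr_def)
    ultimately show ?thesis
      by (simp add: exp_add[symmetric] \<delta>_def algebra_simps)
  qed
  show ?thesis
    by (rule Lim_transform_eventually[OF lim eventually_sequentiallyI[of 1]]) (rule eq, simp)
qed

theorem theorem1:
  fixes M :: "nat \<Rightarrow> 'a measure" and T :: "nat \<Rightarrow> 'a \<Rightarrow> nat set set"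
  assumes "\<And>n. n \<ge> 3 \<Longrightarrow> determinantal_hypertree n (M n) (T n)"
  shows "\<forall>\<epsilon>::real. \<epsilon> > 0 \<longrightarrow> (\<lambda>n. measure (M n)
            {\<omega> \<in> space (M n). \<bar>real (dim_H1_F2 (T n \<omega>)) / (real n)\<^sup>2\<bar> > \<epsilon>})
          \<longlonglongrightarrow> 0"
proof (intro allI impI)
  fix \<epsilon> :: real assume \<epsilon>: "\<epsilon> > 0"
  then have "\<epsilon> * ln 2 > 0" by simp
  \<comment> \<open>The sampling parameter depends on \<open>\<epsilon>\<close> alone and stays
    fixed as \<open>n\<close> grows, so the cost \<open>n * q ^ 4\<close> of the union bound is only
    linear in \<open>n\<close>.\<close>
  then obtain p where p: "1 / real (Suc p) < \<epsilon> * ln 2"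
    using nat_approx_posE by blast
  let ?q = "Suc p"
  show "(\<lambda>n. measure (M n) {\<omega> \<in> space (M n). \<bar>real (dim_H1_F2 (T n \<omega>)) / (real n)\<^sup>2\<bar> > \<epsilon>}) \<longlonglongrightarrow> 0"
  proof (rule tendsto_sandwich[OF _ _ tendsto_const tail_bound_tendsto_zero[OF p]])
    show "\<forall>\<^sub>F n in sequentially.
        measure (M n) {\<omega> \<in> space (M n). \<bar>real (dim_H1_F2 (T n \<omega>)) / (real n)\<^sup>2\<bar> > \<epsilon>} \<le>
        2 powr (- \<epsilon> * (real n)\<^sup>2) * (real n ^ n * 2 ^ (n * ?q ^ 4 + n) * exp ((real n)\<^sup>2 / real ?q))"
      using determinantal_hypertree_tail[OF assms _ _ \<epsilon>, where q = ?q]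
      by (intro eventually_sequentiallyI[of 3]) simp
  qed simp
qed

end
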